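(* Suppose $E:\mathcal{P}_{2,\omega_0}(\mathbb{R}^d)\to\mathbb{R}\cup\{+\infty\}$ is proper, coercive, lower semicontinuous and $\lambda$-convex along generalized geodesics for some $\lambda\in\mathbb{R}$. Then for $\mu\in D(|\partial E|)$, $0<h\le\tau<\frac1{\lambda^-}$ and integers $n,m\ge1$, $$(1-\lambda^-h)^2W_2^2(J^n_\tau\mu,J^m_h\mu)\le\frac h\tau(1-\lambda^-\tau)^{-1}W_2^2(J^{n-1}_\tau\mu,J^{m-1}_h\mu)+\frac{\tau-h}{\tau}W_2^2(J^{m-1}_h\mu,J^n_\tau\mu)+2h^2(1-\lambda^-h)^{-2m}|\partial E|^2(\mu).$$
   Context: Fix a probability measure $\omega_0$ on $\mathbb{R}^d$. $W_2$ is the quadratic Wasserstein distance, $\Gamma_0(\mu,\nu)$ the optimal couplings; $\mathcal{P}_{2,\omega_0}(\mathbb{R}^d)=\{\mu:W_2(\mu,\omega_0)<\infty\}$. A transport plan from $\mu_0$ to $\mu_1$ with base $\omega$ is $\boldsymbol\omega\in\mathcal{P}((\mathbb{R}^d)^3)$ with $\pi^{1,2}\#\boldsymbol\omega\in\Gamma_0(\omega,\mu_0)$, $\pi^{1,3}\#\boldsymbol\omega\in\Gamma_0(\omega,\mu_1)$; generalized geodesic $\mu_\alpha=((1-\alpha)\pi^2+\alpha\pi^3)\#\boldsymbol\omega$; $W_{2,\boldsymbol\omega}(\mu_0,\mu_1)=(\int|x_2-x_3|^2d\boldsymbol\omega)^{1/2}$. $D(E)=\{E<\infty\}$; proper: $D(E)\ne\emptyset$;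 coercive: $\exists\tau_0>0,u_0$ with $\inf_v\{\frac1{2\tau_0}W_2^2(u_0,v)+E(v)\}>-\infty$; lower semicontinuous w.r.t. $W_2$; $\lambda$-convex along generalized geodesics: for all $\mu_0,\mu_1,\omega$ there is a generalized geodesic from $\mu_0$ to $\mu_1$ with base $\omega$ (induced by some $\boldsymbol\omega$) with $E(\mu_\alpha)\le(1-\alpha)E(\mu_0)+\alpha E(\mu_1)-\alpha(1-\alpha)\frac\lambda2W^2_{2,\boldsymbol\omega}(\mu_0,\mu_1)$. $\lambda^-=\max\{0,-\lambda\}$, $1/\lambda^-=+\infty$ if $\lambda^-=0$. $J_\tau\mu=\operatorname{argmin}_\nu\{\frac1{2\tau}W_2^2(\mu,\nu)+E(\nu)\}$ (well defined for $\mu$ in the $W_2$-closure of $D(E)$ and $0<\tau<1/\lambda^-$), $J^n_\tau$ its $n$-fold iterate, $J^0_\tau\mu=\mu$. Metric slope $|\partial E|(\mu)=\limsup_{\nu\to\mu}(E(\mu)-E(\nu))^+/W_2(\mu,\nu)$; $D(|\partial E|)=\{\mu\in D(E):|\partial E|(\mu)<\infty\}$. *)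

theory Defs
  imports "HOL-Probability.Probability"
begin

definition couplings :: "'a::euclidean_space measure \<Rightarrow> 'a measure \<Rightarrow> ('a \<times> 'a) measure set" where
  "couplings \<mu> \<nu> = {\<gamma>. prob_space \<gamma> \<and> sets \<gamma> = sets borel \<and>
      distr \<gamma> borel fst = \<mu> \<and> distr \<gamma> borel snd = \<nu>}"

definition cost2 :: "('a::euclidean_space \<times> 'a) measure \<Rightarrow> ennreal" where
  "cost2 \<gamma> = (\<integral>\<^sup>+ p. ennreal ((norm (fst p - snd p))\<^sup>2) \<partial>\<gamma>)"

definition W2sq :: "'a::euclidean_space measure \<Rightarrow> 'a measure \<Rightarrow> ennreal" where
  "W2sq \<mu> \<nu> = (INF \<gamma>\<in>couplings \<mu> \<nu>. cost2 \<gamma>)"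

text \<open>Wasserstein distance as a real number (used only where it is finite).\<close>
definition W2 :: "'a::euclidean_space measure \<Rightarrow> 'a measure \<Rightarrow> real" where
  "W2 \<mu> \<nu> = sqrt (enn2real (W2sq \<mu> \<nu>))"

definition opt_couplings :: "'a::euclidean_space measure \<Rightarrow> 'a measure \<Rightarrow> ('a \<times> 'a) measure set" where
  "opt_couplings \<mu> \<nu> = {\<gamma>\<in>couplings \<mu> \<nu>. cost2 \<gamma> = W2sq \<mu> \<nu>}"

definition P2 :: "'a::euclidean_space measure \<Rightarrow> 'a measure set" where
  "P2 \<omega>0 = {\<mu>. prob_space \<mu> \<and> sets \<mu> = sets borel \<and> W2sq \<mu> \<omega>0 < \<infinity>}"

definition pi12 :: "'a \<times> 'a \<times> 'a \<Rightarrow> 'a \<times> 'a" where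
  "pi12 x = (fst x, fst (snd x))"
definition pi13 :: "'a \<times> 'a \<times> 'a \<Rightarrow> 'a \<times> 'a" where
  "pi13 x = (fst x, snd (snd x))"

definition transport_plans ::
  "'a::euclidean_space measure \<Rightarrow> 'a measure \<Rightarrow> 'a measure \<Rightarrow> ('a \<times> 'a \<times> 'a) measure set" where
  "transport_plans \<omega> \<mu>0 \<mu>1 = {\<Omega>. prob_space \<Omega> \<and> sets \<Omega> = sets borel \<and>
      distr \<Omega> borel pi12 \<in> opt_couplings \<omega> \<mu>0 \<and> distr \<Omega> borel pi13 \<in> opt_couplings \<omega> \<mu>1}"

definition gen_geod :: "('a::euclidean_space \<times> 'a \<times> 'a) measure \<Rightarrow> real \<Rightarrow> 'a measure" where
  "gen_geod \<Omega> \<alpha> = distr \<Omega> borel (\<lambda>x. (1 - \<alpha>) *\<^sub>R fst (snd x) + \<alpha> *\<^sub>R snd (snd x))"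

definition W2plan_sq :: "('a::euclidean_space \<times> 'a \<times> 'a) measure \<Rightarrow> ennreal" where
  "W2plan_sq \<Omega> = (\<integral>\<^sup>+ x. ennreal ((norm (fst (snd x) - snd (snd x)))\<^sup>2) \<partial>\<Omega>)"

definition proper_fun :: "'a::euclidean_space measure \<Rightarrow> ('a measure \<Rightarrow> ereal) \<Rightarrow> bool" where
  "proper_fun \<omega>0 E \<longleftrightarrow> (\<exists>\<mu>\<in>P2 \<omega>0. E \<mu> < \<infinity>)"

definition coercive :: "'a::euclidean_space measure \<Rightarrow> ('a measure \<Rightarrow> ereal) \<Rightarrow> bool" where
  "coercive \<omega>0 E \<longleftrightarrow> (\<exists>\<tau>0>0. \<exists>u0\<in>P2 \<omega>0.
      (INF v\<in>P2 \<omega>0. enn2ereal (W2sq u0 v) / ereal (2 * \<tau>0) + E v) > - \<infinity>)"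

definition W2_lsc :: "'a::euclidean_space measure \<Rightarrow> ('a measure \<Rightarrow> ereal) \<Rightarrow> bool" where
  "W2_lsc \<omega>0 E \<longleftrightarrow> (\<forall>\<mu> s. \<mu> \<in> P2 \<omega>0 \<longrightarrow> (\<forall>n. s n \<in> P2 \<omega>0) \<longrightarrow>
      (\<lambda>n. W2 (s n) \<mu>) \<longlonglongrightarrow> 0 \<longrightarrow> E \<mu> \<le> liminf (\<lambda>n. E (s n)))"

definition convex_gen_geod ::
  "'a::euclidean_space measure \<Rightarrow> real \<Rightarrow> ('a measure \<Rightarrow> ereal) \<Rightarrow> bool" where
  "convex_gen_geod \<omega>0 lam E \<longleftrightarrow> (\<forall>\<mu>0\<in>P2 \<omega>0. \<forall>\<mu>1\<in>P2 \<omega>0. \<forall>\<omega>\<in>P2 \<omega>0.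
      \<exists>\<Omega>\<in>transport_plans \<omega> \<mu>0 \<mu>1. \<forall>\<alpha>\<in>{0..1}.
        E (gen_geod \<Omega> \<alpha>) \<le> ereal (1 - \<alpha>) * E \<mu>0 + ereal \<alpha> * E \<mu>1
            - ereal (\<alpha> * (1 - \<alpha>) * (lam / 2) * enn2real (W2plan_sq \<Omega>)))"

definition neg_part :: "real \<Rightarrow> real" where
  "neg_part lam = max 0 (- lam)"

text \<open>Resolvent (minimizing movement step) J_\<tau>; it is the unique minimizer when it exists.\<close>
definition resolvent ::
  "'a::euclidean_space measure \<Rightarrow> ('a measure \<Rightarrow> ereal) \<Rightarrow> real \<Rightarrow> 'a measure \<Rightarrow> 'a measure" where
  "resolvent \<omega>0 E \<tau> \<mu> = (SOME \<nu>. \<nu> \<in> P2 \<omega>0 \<and> (\<forall>\<nu>'\<in>P2 \<omega>0.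
      enn2ereal (W2sq \<mu> \<nu>) / ereal (2 * \<tau>) + E \<nu> \<le> enn2ereal (W2sq \<mu> \<nu>') / ereal (2 * \<tau>) + E \<nu>'))"

definition slope :: "'a::euclidean_space measure \<Rightarrow> ('a measure \<Rightarrow> ereal) \<Rightarrow> 'a measure \<Rightarrow> ereal" where
  "slope \<omega>0 E \<mu> = (INF r\<in>{0<..}. SUP \<nu>\<in>{\<nu>\<in>P2 \<omega>0. 0 < W2 \<mu> \<nu> \<and> W2 \<mu> \<nu> < r}.
      max 0 (E \<mu> - E \<nu>) / ereal (W2 \<mu> \<nu>))"

definition dom_slope :: "'a::euclidean_space measure \<Rightarrow> ('a measure \<Rightarrow> ereal) \<Rightarrow> 'a measure set" where
  "dom_slope \<omega>0 E = {\<mu>\<in>P2 \<omega>0. E \<mu> < \<infinity> \<and> slope \<omega>0 E \<mu> < \<infinity>}"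

end

theory Submission
  imports Defs
begin

text \<open>
  Along a generalized geodesic with base \<open>\<omega>\<close> the function \<open>\<nu> \<mapsto> W\<^sub>2\<^sup>2(\<omega>,\<nu>) / (2\<tau>) + E \<nu>\<close> is
  \<open>(1/\<tau> - \<lambda>\<^sup>-)\<close>-convex. Hence minimizing sequences are Cauchy, so minimizers exist by completeness
  of \<open>W\<^sub>2\<close>, and every minimizer \<open>J\<close> satisfies the discrete variational inequality
  \<open>(1 - \<lambda>\<^sup>-\<tau>) W\<^sub>2\<^sup>2(J,\<nu>) - W\<^sub>2\<^sup>2(\<omega>,\<nu>) \<le> 2\<tau> (E \<nu> - E J) - W\<^sub>2\<^sup>2(\<omega>,J)\<close>. The theorem combines this inequality
  for the step of size \<open>\<tau>\<close> and the step of size \<open>h\<close>; the energy drop in the \<open>h\<close>-step is bounded by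
  the slope of \<open>\<mu>\<close> because the increments of the scheme grow by at most \<open>(1 - \<lambda>\<^sup>-h)\<^sup>-\<^sup>1\<close> per step.

  The triangle inequality comes from the transport plans provided by the convexity hypothesis.
  Completeness comes from realising a sequence of measures as the marginals of a Markov chain:
  conditioning a coupling on the countably many cells of a fine partition gives an explicit kernel
  with the exact second marginal and almost the same cost, so no disintegration theorem is needed.
\<close>

section \<open>Gluing couplings by a Markov chain\<close>

lemma nn_integral_countable_partition:
  fixes j :: "'b \<Rightarrow> nat" and G :: "nat \<Rightarrow> 'b \<Rightarrow> ennreal"
  assumes [measurable]: "j \<in> M \<rightarrow>\<^sub>M count_space UNIV" "\<And>c. G c \<in> borel_measurable M"
  shows "(\<integral>\<^sup>+ p. G (j p) p \<partial>M) = (\<Sum>c. \<integral>\<^sup>+ p. G c p * indicator {q\<in>space M. j q = c} p \<partial>M)"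
proof -
  have "(\<Sum>c. \<integral>\<^sup>+ p. G c p * indicator {q\<in>space M. j q = c} p \<partial>M)
      = (\<integral>\<^sup>+ p. (\<Sum>c. G c p * indicator {q\<in>space M. j q = c} p) \<partial>M)"
    by (intro nn_integral_suminf[symmetric]) measurable
  also have "\<dots> = (\<integral>\<^sup>+ p. G (j p) p \<partial>M)"
  proof (intro nn_integral_cong)
    fix p assume p: "p \<in> space M"
    have "(\<lambda>c. G c p * indicator {q\<in>space M. j q = c} p) sums
        (\<Sum>c\<in>{j p}. G c p * indicator {q\<in>space M. j q = c} p)"
      by (intro sums_finite) auto
    then show "(\<Sum>c. G c p * indicator {q\<in>space M. j q = c} p) = G (j p) p"
      using p by (simp add: sums_iff)
  qed
  finally show ?thesis by simp
qed

text \<open>\<open>K y\<close> is the law of the second coordinate given that the first lies in the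
  cell of \<open>y\<close>. The exchange formula holds because the integrand sees \<open>y\<close>
  only through its cell: integrating over a cell multiplies the conditional mean by the mass of the
  cell, which undoes the normalisation.\<close>

lemma cell_kernel:
  fixes \<gamma> :: "('a::euclidean_space \<times> 'a) measure" and j :: "'a \<Rightarrow> nat"
  assumes \<gamma>: "prob_space \<gamma>" "sets \<gamma> = sets borel"
    and j[measurable]: "j \<in> borel \<rightarrow>\<^sub>M count_space UNIV"
  obtains K where "K \<in> borel \<rightarrow>\<^sub>M subprob_algebra borel" and "\<And>y. prob_space (K y)"
    and "\<And>f :: nat \<Rightarrow> 'a \<Rightarrow> ennreal. (\<And>c. f c \<in> borel_measurable borel) \<Longrightarrow>
      (\<integral>\<^sup>+ y. (\<integral>\<^sup>+ z. f (j y) z \<partial>K y) \<partial>distr \<gamma> borel fst) = (\<integral>\<^sup>+ p. f (j (fst p)) (snd p) \<partial>\<gamma>)"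
proof -
  interpret prob_space \<gamma> by fact
  note [measurable_cong] = \<gamma>(2)
  have sp: "space \<gamma> = UNIV" using \<gamma>(2) by (metis sets_eq_imp_space_eq space_borel)
  have fst_m[measurable]: "fst \<in> \<gamma> \<rightarrow>\<^sub>M borel" and snd_m[measurable]: "snd \<in> \<gamma> \<rightarrow>\<^sub>M borel"
    by (auto simp: measurable_cong_sets[OF \<gamma>(2) refl] borel_prod[symmetric])
  define cell where "cell c = {q\<in>space \<gamma>. j (fst q) = c}" for c
  have [measurable]: "cell c \<in> sets \<gamma>" for c unfolding cell_def by measurable
  \<comment> \<open>A null cell cannot be normalised; the second marginal is the default there, so
    that every \<open>K y\<close> is a probability measure. Such a cell contributes zero to both
    integrals.\<close>
  define Kc where "Kc c = (if emeasure \<gamma> (cell c) = 0 then distr \<gamma> borel snd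
      else distr (uniform_measure \<gamma> (cell c)) borel snd)" for c
  have Kc: "prob_space (Kc c)" "sets (Kc c) = sets borel" for c
    using prob_space_uniform_measure[of \<gamma> "cell c"]
    by (auto simp: Kc_def intro!: prob_space_distr prob_space.prob_space_distr)
  have Kc_int: "(\<integral>\<^sup>+ z. g z \<partial>Kc c) * emeasure \<gamma> (cell c) = (\<integral>\<^sup>+ p. g (snd p) * indicator (cell c) p \<partial>\<gamma>)"
    if [measurable]: "g \<in> borel_measurable borel" for g :: "'a \<Rightarrow> ennreal" and c
  proof (cases "emeasure \<gamma> (cell c) = 0")
    case True
    then have "AE p in \<gamma>. p \<notin> cell c" by (simp add: AE_iff_measurable[OF _ refl] cell_def)
    then have "(\<integral>\<^sup>+ p. g (snd p) * indicator (cell c) p \<partial>\<gamma>) = (\<integral>\<^sup>+ p. 0 \<partial>\<gamma>)"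
      by (intro nn_integral_cong_AE) auto
    then show ?thesis using True by simp
  next
    case False
    then have "emeasure \<gamma> (cell c) / emeasure \<gamma> (cell c) = 1"
      by (intro ennreal_divide_self) (auto simp: less_top[symmetric])
    with False show ?thesis
      by (simp add: Kc_def nn_integral_distr nn_integral_uniform_measure ennreal_divide_times)
  qed
  define K where "K y = Kc (j y)" for y
  show thesis
  proof
    show "K \<in> borel \<rightarrow>\<^sub>M subprob_algebra borel" unfolding K_def
      by (rule measurable_compose_countable[OF _ j])
        (simp add: space_subprob_algebra Kc prob_space_imp_subprob_space)
    show "prob_space (K y)" for y using Kc by (simp add: K_def)
    fix f :: "nat \<Rightarrow> 'a \<Rightarrow> ennreal" assume f[measurable]: "\<And>c. f c \<in> borel_measurable borel"
    have "(\<integral>\<^sup>+ y. (\<integral>\<^sup>+ z. f (j y) z \<partial>K y) \<partial>distr \<gamma> borel fst)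
        = (\<integral>\<^sup>+ p. (\<integral>\<^sup>+ z. f (j (fst p)) z \<partial>Kc (j (fst p))) \<partial>\<gamma>)"
      unfolding K_def by (subst nn_integral_distr)
        (auto intro!: measurable_compose_countable[OF _ j])
    also have "\<dots> = (\<Sum>c. \<integral>\<^sup>+ p. (\<integral>\<^sup>+ z. f c z \<partial>Kc c) * indicator (cell c) p \<partial>\<gamma>)"
      unfolding cell_def
      by (rule nn_integral_countable_partition[where j="\<lambda>p. j (fst p)"]) auto
    also have "\<dots> = (\<Sum>c. \<integral>\<^sup>+ p. f c (snd p) * indicator (cell c) p \<partial>\<gamma>)"
      by (simp add: nn_integral_cmult_indicator Kc_int)
    also have "\<dots> = (\<integral>\<^sup>+ p. f (j (fst p)) (snd p) \<partial>\<gamma>)"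
      unfolding cell_def
      by (rule nn_integral_countable_partition[where j="\<lambda>p. j (fst p)", symmetric]) auto
    finally show "(\<integral>\<^sup>+ y. (\<integral>\<^sup>+ z. f (j y) z \<partial>K y) \<partial>distr \<gamma> borel fst)
        = (\<integral>\<^sup>+ p. f (j (fst p)) (snd p) \<partial>\<gamma>)" .
  qed
qed

text \<open>The points \<open>d\<close> enumerate a countable dense set; taking the least index
  within distance \<epsilon> makes the choice measurable.\<close>

lemma countable_rounding:
  fixes \<epsilon> :: real assumes "0 < \<epsilon>"
  obtains d :: "nat \<Rightarrow> 'a::euclidean_space" and j :: "'a \<Rightarrow> nat"
  where "j \<in> borel \<rightarrow>\<^sub>M count_space UNIV" "\<And>y. norm (y - d (j y)) \<le> \<epsilon>"
proof -
  obtain D :: "'a set" where D: "countable D" "\<And>X. open X \<Longrightarrow> X \<noteq> {} \<Longrightarrow> \<exists>d\<in>D. d \<in> X"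
    using countable_dense_setE by blast
  have "D \<noteq> {}" using D(2)[of UNIV] by auto
  define d where "d = from_nat_into D"
  define j where "j y = (LEAST k. dist y (d k) < \<epsilon>)" for y
  have ex: "\<exists>k. dist y (d k) < \<epsilon>" for y
  proof -
    obtain z where "z \<in> D" "z \<in> ball y \<epsilon>" using D(2)[of "ball y \<epsilon>"] assms by auto
    moreover then obtain k where "d k = z"
      using from_nat_into_surj[OF D(1)] unfolding d_def by metis
    ultimately show ?thesis by auto
  qed
  show thesis
  proof
    show "j \<in> borel \<rightarrow>\<^sub>M count_space UNIV" unfolding j_def by measurable
    show "norm (y - d (j y)) \<le> \<epsilon>" for y
      using LeastI_ex[OF ex, of y] by (simp add: j_def dist_norm)
  qed
qed

lemma norm_diff_square_le:
  fixes x y z :: "'a::real_normed_vector"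
  shows "(norm (x - z))\<^sup>2 \<le> 2 * (norm (x - y))\<^sup>2 + 2 * (norm (y - z))\<^sup>2"
proof -
  have "norm (x - z) \<le> norm (x - y) + norm (y - z)" using norm_triangle_ineq[of "x - y" "y - z"] by simp
  then have "(norm (x - z))\<^sup>2 \<le> (norm (x - y) + norm (y - z))\<^sup>2" by (intro power_mono) auto
  also have "\<dots> \<le> 2 * (norm (x - y))\<^sup>2 + 2 * (norm (y - z))\<^sup>2"
    using sum_squares_bound[of "norm (x - y)" "norm (y - z)"] by (simp add: power2_sum)
  finally show ?thesis .
qed

text \<open>Conditioning on cells of radius \<epsilon> keeps the second marginal exact; only the
  cost suffers, because \<open>y\<close> is replaced by the centre of its cell.\<close>

lemma approx_kernel:
  fixes \<mu> \<nu> :: "'a::euclidean_space measure" and \<epsilon> :: real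
  assumes \<gamma>: "\<gamma> \<in> couplings \<mu> \<nu>" and "0 < \<epsilon>"
  obtains K where "K \<in> borel \<rightarrow>\<^sub>M subprob_algebra borel" and "\<And>y. prob_space (K y)"
    and "\<And>g. g \<in> borel_measurable borel \<Longrightarrow> (\<integral>\<^sup>+ y. (\<integral>\<^sup>+ z. g z \<partial>K y) \<partial>\<mu>) = (\<integral>\<^sup>+ z. g z \<partial>\<nu>)"
    and "(\<integral>\<^sup>+ y. (\<integral>\<^sup>+ z. ennreal ((norm (y - z))\<^sup>2) \<partial>K y) \<partial>\<mu>) \<le> ennreal (6 * \<epsilon>\<^sup>2) + 4 * cost2 \<gamma>"
proof -
  have \<gamma>': "prob_space \<gamma>" "sets \<gamma> = sets borel" and \<mu>: "distr \<gamma> borel fst = \<mu>" and \<nu>: "distr \<gamma> borel snd = \<nu>"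
    using \<gamma> by (auto simp: couplings_def)
  interpret prob_space \<gamma> by fact
  note [measurable_cong] = \<gamma>'(2)
  have fst_m[measurable]: "fst \<in> \<gamma> \<rightarrow>\<^sub>M borel" and snd_m[measurable]: "snd \<in> \<gamma> \<rightarrow>\<^sub>M borel"
    by (auto simp: measurable_cong_sets[OF \<gamma>'(2) refl] borel_prod[symmetric])
  have s\<mu>[measurable_cong]: "sets \<mu> = sets borel" using \<mu> by auto
  interpret \<mu>: prob_space \<mu> unfolding \<mu>[symmetric] by (rule prob_space_distr) measurable
  obtain d :: "nat \<Rightarrow> 'a" and j where j[measurable]: "j \<in> borel \<rightarrow>\<^sub>M count_space UNIV"
    and d: "\<And>y. norm (y - d (j y)) \<le> \<epsilon>"
    using countable_rounding[OF assms(2)] by metis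
  have d2: "(norm (y - d (j y)))\<^sup>2 \<le> \<epsilon>\<^sup>2" for y using d by (intro power_mono) auto
  obtain K where K[measurable]: "K \<in> borel \<rightarrow>\<^sub>M subprob_algebra borel" and Kp: "\<And>y. prob_space (K y)"
    and Kint: "\<And>f :: nat \<Rightarrow> 'a \<Rightarrow> ennreal. (\<And>c. f c \<in> borel_measurable borel) \<Longrightarrow>
      (\<integral>\<^sup>+ y. (\<integral>\<^sup>+ z. f (j y) z \<partial>K y) \<partial>\<mu>) = (\<integral>\<^sup>+ p. f (j (fst p)) (snd p) \<partial>\<gamma>)"
    using cell_kernel[OF \<gamma>' j] unfolding \<mu> by metis
  have Ks[measurable_cong]: "sets (K y) = sets borel" for y
    using subprob_measurableD(2)[OF K, of y] by simp
  show thesis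
  proof
    show "K \<in> borel \<rightarrow>\<^sub>M subprob_algebra borel" "\<And>y. prob_space (K y)" by fact+
    show "(\<integral>\<^sup>+ y. (\<integral>\<^sup>+ z. g z \<partial>K y) \<partial>\<mu>) = (\<integral>\<^sup>+ z. g z \<partial>\<nu>)" if [measurable]: "g \<in> borel_measurable borel" for g
      using Kint[of "\<lambda>_. g"] by (simp add: nn_integral_distr flip: \<nu>)
    have dm[measurable]: "(\<lambda>y. d (j y)) \<in> borel \<rightarrow>\<^sub>M borel"
      by (rule measurable_compose[OF j]) simp
    have "(\<integral>\<^sup>+ y. (\<integral>\<^sup>+ z. ennreal ((norm (y - z))\<^sup>2) \<partial>K y) \<partial>\<mu>)
      \<le> (\<integral>\<^sup>+ y. (\<integral>\<^sup>+ z. ennreal (2 * \<epsilon>\<^sup>2 + 2 * (norm (d (j y) - z))\<^sup>2) \<partial>K y) \<partial>\<mu>)"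
    proof (intro nn_integral_mono ennreal_leI)
      show "(norm (y - z))\<^sup>2 \<le> 2 * \<epsilon>\<^sup>2 + 2 * (norm (d (j y) - z))\<^sup>2" for y z
        using norm_diff_square_le[of y z "d (j y)"] d2[of y] by linarith
    qed
    \<comment> \<open>The integrand now depends on \<open>y\<close> only through its cell, so the
      kernel can be traded for \<gamma>. Returning to the true first coordinate doubles once more:
      \<open>2 * \<epsilon>\<^sup>2 + 2 * (2 * \<epsilon>\<^sup>2 + 2 * c)\<close> explains the
      constants 6 and 4.\<close>
    also have "\<dots> = (\<integral>\<^sup>+ p. ennreal (2 * \<epsilon>\<^sup>2 + 2 * (norm (d (j (fst p)) - snd p))\<^sup>2) \<partial>\<gamma>)"
      by (rule Kint[of "\<lambda>c z. ennreal (2 * \<epsilon>\<^sup>2 + 2 * (norm (d c - z))\<^sup>2)"]) measurable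
    also have "\<dots> \<le> (\<integral>\<^sup>+ p. ennreal (6 * \<epsilon>\<^sup>2) + 4 * ennreal ((norm (fst p - snd p))\<^sup>2) \<partial>\<gamma>)"
    proof (intro nn_integral_mono)
      fix p
      have "2 * \<epsilon>\<^sup>2 + 2 * (norm (d (j (fst p)) - snd p))\<^sup>2 \<le> 6 * \<epsilon>\<^sup>2 + 4 * (norm (fst p - snd p))\<^sup>2"
        using norm_diff_square_le[of "d (j (fst p))" "snd p" "fst p"] d2[of "fst p"]
        by (simp add: norm_minus_commute[of "d (j (fst p))"])
      then show "ennreal (2 * \<epsilon>\<^sup>2 + 2 * (norm (d (j (fst p)) - snd p))\<^sup>2)
          \<le> ennreal (6 * \<epsilon>\<^sup>2) + 4 * ennreal ((norm (fst p - snd p))\<^sup>2)"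
        by (subst (asm) ennreal_le_iff[symmetric]) (simp_all add: ennreal_mult)
    qed
    also have "\<dots> = ennreal (6 * \<epsilon>\<^sup>2) + 4 * cost2 \<gamma>"
      by (simp add: nn_integral_add nn_integral_cmult cost2_def emeasure_space_1)
    finally show "(\<integral>\<^sup>+ y. (\<integral>\<^sup>+ z. ennreal ((norm (y - z))\<^sup>2) \<partial>K y) \<partial>\<mu>) \<le> ennreal (6 * \<epsilon>\<^sup>2) + 4 * cost2 \<gamma>" .
  qed
qed

section \<open>Markov chains with prescribed kernels\<close>

text \<open>The Ionescu-Tulcea theorem is applied to kernels that look only at the last coordinate.
  The compatibility of \<open>s\<close> and \<open>K\<close> propagates the one-dimensional laws by
  induction, and one further step gives the law of two neighbouring coordinates.\<close>

lemma markov_chain_exists: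
  fixes s :: "nat \<Rightarrow> 'a::euclidean_space measure" and K :: "nat \<Rightarrow> 'a \<Rightarrow> 'a measure"
  assumes s0: "prob_space (s 0)" "sets (s 0) = sets borel"
    and K[measurable]: "\<And>n. K n \<in> borel \<rightarrow>\<^sub>M subprob_algebra borel" and Kp: "\<And>n y. prob_space (K n y)"
    and s: "\<And>n g. g \<in> borel_measurable borel \<Longrightarrow>
      (\<integral>\<^sup>+ y. (\<integral>\<^sup>+ z. g z \<partial>K n y) \<partial>s n) = (\<integral>\<^sup>+ z. g z \<partial>s (Suc n))"
  obtains M :: "(nat \<Rightarrow> 'a) measure" where "sets M = sets (PiM UNIV (\<lambda>_. borel))"
    and "\<And>n f. f \<in> borel_measurable (borel \<Otimes>\<^sub>M borel) \<Longrightarrow>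
      (\<integral>\<^sup>+ \<omega>. f (\<omega> n, \<omega> (Suc n)) \<partial>M) = (\<integral>\<^sup>+ y. (\<integral>\<^sup>+ z. f (y, z) \<partial>K n y) \<partial>s n)"
proof -
  have Ks[measurable_cong]: "sets (K n y) = sets borel" for n y
    using subprob_measurableD(2)[OF K, of y] by simp
  define P where "P i = (case i of 0 \<Rightarrow> (\<lambda>_. s 0) | Suc n \<Rightarrow> (\<lambda>\<omega>. K n (\<omega> n)))" for i :: nat
  interpret IT: Ionescu_Tulcea P "\<lambda>_. borel :: 'a measure"
  proof (rule Ionescu_Tulcea.intro)
    show "P i \<in> PiM {0..<i} (\<lambda>_. borel) \<rightarrow>\<^sub>M subprob_algebra borel" for i
    proof (cases i)
      case 0 then show ?thesis using s0
        by (auto simp: P_def space_subprob_algebra intro!: measurable_const prob_space_imp_subprob_space)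
    next
      case (Suc n)
      have "(\<lambda>\<omega>. \<omega> n) \<in> PiM {0..<i} (\<lambda>_. borel) \<rightarrow>\<^sub>M borel"
        using Suc by (intro measurable_component_singleton) auto
      from measurable_compose[OF this K] show ?thesis using Suc by (simp add: P_def)
    qed
  next
    show "prob_space (P i x)" for i x
      using s0 Kp by (cases i) (auto simp: P_def)
  qed
  \<comment> \<open>\<open>?C n\<close> is the joint law of the coordinates in
    \<open>{0..<n}\<close>, so coordinate \<open>n\<close> first exists under
    \<open>?C (Suc n)\<close>; \<open>\<lambda>_. undefined\<close> is the only point of the empty
    product.\<close>
  let ?C = "\<lambda>n. IT.C 0 n (\<lambda>_. undefined)"
  let ?B = "\<lambda>n::nat. PiM {0..<n} (\<lambda>_. borel :: 'a measure)"
  have u: "(\<lambda>_. undefined) \<in> space (?B 0)" by (simp add: space_PiM)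
  have sC[measurable_cong]: "sets (?C n) = sets (?B n)" for n
    using IT.sets_C[OF u, of n] by simp
  have spC: "space (?C n) = space (?B n)" for n using sets_eq_imp_space_eq[OF sC] .
  have C_Suc: "(\<integral>\<^sup>+ \<omega>. f \<omega> \<partial>?C (Suc n)) = (\<integral>\<^sup>+ \<omega>. (\<integral>\<^sup>+ z. f (fun_upd \<omega> n z) \<partial>P n \<omega>) \<partial>?C n)"
    if f: "f \<in> borel_measurable (?B (Suc n))" for f n
  proof -
    have "(\<integral>\<^sup>+ \<omega>. f \<omega> \<partial>?C (Suc n)) = (\<integral>\<^sup>+ \<omega>. (\<integral>\<^sup>+ \<omega>'. f \<omega>' \<partial>IT.eP n \<omega>) \<partial>?C n)"
      using nn_integral_bind[OF f, of "IT.eP n" "?C n"] by (simp add: measurable_cong_sets[OF sC refl] IT.measurable_eP)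
    also have "\<dots> = (\<integral>\<^sup>+ \<omega>. (\<integral>\<^sup>+ z. f (fun_upd \<omega> n z) \<partial>P n \<omega>) \<partial>?C n)"
      by (intro nn_integral_cong IT.nn_integral_eP f) (simp add: spC)
    finally show ?thesis .
  qed
  have comp[measurable]: "(\<lambda>\<omega>. \<omega> k) \<in> ?B n \<rightarrow>\<^sub>M borel" if "k < n" for k n
    using that by (intro measurable_component_singleton) auto
  have law: "(\<integral>\<^sup>+ \<omega>. g (\<omega> n) \<partial>?C (Suc n)) = (\<integral>\<^sup>+ z. g z \<partial>s n)"
    if g: "g \<in> borel_measurable borel" for g n
    using g
  proof (induction n arbitrary: g)
    case 0
    have "(\<integral>\<^sup>+ \<omega>. g (\<omega> 0) \<partial>?C (Suc 0)) = (\<integral>\<^sup>+ \<omega>. (\<integral>\<^sup>+ z. g z \<partial>s 0) \<partial>?C 0)"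
      using 0 by (subst C_Suc) (auto simp: P_def intro!: measurable_compose[OF comp])
    also have "\<dots> = (\<integral>\<^sup>+ z. g z \<partial>s 0)"
      using prob_space.emeasure_space_1[OF IT.prob_space_C[OF u, of 0]] by simp
    finally show ?case .
  next
    case (Suc n)
    note [measurable] = Suc.prems
    have "(\<integral>\<^sup>+ \<omega>. g (\<omega> (Suc n)) \<partial>?C (Suc (Suc n))) = (\<integral>\<^sup>+ \<omega>. (\<integral>\<^sup>+ z. g z \<partial>K n (\<omega> n)) \<partial>?C (Suc n))"
      by (subst C_Suc) (auto simp: P_def intro!: measurable_compose[OF comp] simp del: IT.C.simps)
    also have "\<dots> = (\<integral>\<^sup>+ y. (\<integral>\<^sup>+ z. g z \<partial>K n y) \<partial>s n)"
      by (rule Suc.IH) (rule nn_integral_measurable_subprob_algebra2[where N=borel], measurable)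
    finally show ?case using s Suc.prems by simp
  qed
  \<comment> \<open>The limit measure is compared with \<open>?C\<close> at the least level covering
    a finite index set; for an initial segment this level is its length.\<close>
  have upto: "IT.up_to {0..<n} = n" for n
  proof (rule antisym)
    show "IT.up_to {0..<n} \<le> n" by (simp add: IT.up_to_iff)
    show "n \<le> IT.up_to {0..<n}" using IT.up_to_less[of "{0..<n}" "n - 1"] by (cases n) auto
  qed
  have lim: "(\<integral>\<^sup>+ \<omega>. f (restrict \<omega> {0..<n}) \<partial>IT.PF.lim) = (\<integral>\<^sup>+ \<omega>. f \<omega> \<partial>?C n)"
    if f: "f \<in> borel_measurable (?B n)" for f n
  proof -
    have "(\<integral>\<^sup>+ \<omega>. f (restrict \<omega> {0..<n}) \<partial>IT.PF.lim)
        = (\<integral>\<^sup>+ \<omega>. f \<omega> \<partial>distr IT.PF.lim (?B n) (\<lambda>x. restrict x {0..<n}))"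
      by (subst nn_integral_distr)
        (auto simp: f measurable_cong_sets[OF IT.PF.sets_lim refl] intro!: measurable_restrict_subset)
    also have "\<dots> = (\<integral>\<^sup>+ \<omega>. f \<omega> \<partial>distr (?C n) (?B n) (\<lambda>x. restrict x {0..<n}))"
      by (simp add: IT.distr_lim IT.CI_def upto)
    also have "\<dots> = (\<integral>\<^sup>+ \<omega>. f (restrict \<omega> {0..<n}) \<partial>?C n)"
      by (subst nn_integral_distr)
        (auto simp: f measurable_cong_sets[OF sC refl] intro!: measurable_restrict_subset)
    also have "\<dots> = (\<integral>\<^sup>+ \<omega>. f \<omega> \<partial>?C n)"
      by (intro nn_integral_cong) (simp add: spC space_PiM PiE_restrict)
    finally show ?thesis .
  qed
  show thesis
  proof
    show "sets IT.PF.lim = sets (PiM UNIV (\<lambda>_. borel :: 'a measure))" by simp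
    fix n and f :: "'a \<times> 'a \<Rightarrow> ennreal" assume f[measurable]: "f \<in> borel_measurable (borel \<Otimes>\<^sub>M borel)"
    have fm: "(\<lambda>\<omega>. f (\<omega> n, \<omega> (Suc n))) \<in> borel_measurable (?B (Suc (Suc n)))"
      by measurable
    have "(\<integral>\<^sup>+ \<omega>. f (\<omega> n, \<omega> (Suc n)) \<partial>IT.PF.lim) = (\<integral>\<^sup>+ \<omega>. f (\<omega> n, \<omega> (Suc n)) \<partial>?C (Suc (Suc n)))"
      using lim[OF fm] by simp
    also have "\<dots> = (\<integral>\<^sup>+ \<omega>. (\<integral>\<^sup>+ z. f (\<omega> n, z) \<partial>K n (\<omega> n)) \<partial>?C (Suc n))"
      by (subst C_Suc[OF fm]) (simp add: P_def)
    also have "\<dots> = (\<integral>\<^sup>+ y. (\<integral>\<^sup>+ z. f (y, z) \<partial>K n y) \<partial>s n)"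
      by (rule law) (rule nn_integral_measurable_subprob_algebra2[where N=borel], measurable)
    finally show "(\<integral>\<^sup>+ \<omega>. f (\<omega> n, \<omega> (Suc n)) \<partial>IT.PF.lim) = (\<integral>\<^sup>+ y. (\<integral>\<^sup>+ z. f (y, z) \<partial>K n y) \<partial>s n)" .
  qed
qed

section \<open>Limits of sequences with weighted increments\<close>

lemma half_power_square: "((1/2) ^ n)\<^sup>2 = (1/4 :: real) ^ n"
  by (simp add: power2_eq_square flip: power_mult_distrib)

text \<open>Each increment is at most \<open>sqrt S * (1/2) ^ k\<close>, so the tail from
  \<open>n\<close> is at most twice its first term; squaring gives the constant 4 and the rate
  \<open>(1/4) ^ n\<close>.\<close>

lemma weighted_increments_limit:
  fixes x :: "nat \<Rightarrow> 'a::banach"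
  assumes S: "\<And>k. 4 ^ k * (norm (x k - x (Suc k)))\<^sup>2 \<le> S"
  shows "convergent x" and "(norm (x n - lim x))\<^sup>2 \<le> 4 * S * (1/4) ^ n"
proof -
  have S0: "0 \<le> S" using order_trans[OF _ S[of 0]] by simp
  have inc: "norm (x (Suc k) - x k) \<le> sqrt S * (1/2) ^ k" for k
  proof (rule power2_le_imp_le)
    have "(norm (x k - x (Suc k)))\<^sup>2 \<le> S * (1/4) ^ k"
      using S[of k] by (simp add: power_one_over pos_le_divide_eq mult.commute)
    also have "\<dots> = (sqrt S * (1/2) ^ k)\<^sup>2"
      using S0 by (simp add: power_mult_distrib half_power_square)
    finally show "(norm (x (Suc k) - x k))\<^sup>2 \<le> (sqrt S * (1/2) ^ k)\<^sup>2"
      by (simp add: norm_minus_commute)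
  qed (use S0 in simp)
  have "summable (\<lambda>k. sqrt S * (1/2 :: real) ^ k)" by (intro summable_mult summable_geometric) simp
  then have "summable (\<lambda>k. x (Suc k) - x k)"
    by (rule summable_comparison_test'[where N=0]) (use inc in simp)
  then have "(\<lambda>n. \<Sum>k<n. x (Suc k) - x k) \<longlonglongrightarrow> (\<Sum>k. x (Suc k) - x k)"
    by (rule summable_LIMSEQ)
  then have "(\<lambda>n. x n - x 0 + x 0) \<longlonglongrightarrow> (\<Sum>k. x (Suc k) - x k) + x 0"
    unfolding sum_lessThan_telescope by (intro tendsto_intros)
  then show conv: "convergent x" by (auto simp: convergent_def)
  \<comment> \<open>The factor \<open>2 - 2 * (1/2) ^ m\<close> is the exact partial geometric sum;
    with the plain factor 2 the induction would not close.\<close>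
  have tail: "norm (x (n + m) - x n) \<le> sqrt S * (1/2) ^ n * (2 - 2 * (1/2) ^ m)" for m
  proof (induction m)
    case (Suc m)
    have "norm (x (n + Suc m) - x n) \<le> norm (x (Suc (n + m)) - x (n + m)) + norm (x (n + m) - x n)"
      using norm_triangle_ineq[of "x (Suc (n + m)) - x (n + m)" "x (n + m) - x n"] by simp
    also have "\<dots> \<le> sqrt S * (1/2) ^ (n + m) + sqrt S * (1/2) ^ n * (2 - 2 * (1/2) ^ m)"
      by (intro add_mono inc Suc)
    finally show ?case by (simp add: power_add algebra_simps)
  qed simp
  have bound: "norm (x (n + m) - x n) \<le> 2 * sqrt S * (1/2) ^ n" for m
  proof -
    have "sqrt S * (1/2) ^ n * (2 - 2 * (1/2) ^ m) \<le> sqrt S * (1/2) ^ n * 2"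
      using S0 by (intro mult_left_mono) auto
    then show ?thesis using tail[of m] by simp
  qed
  have "(\<lambda>m. x (m + n) - x n) \<longlonglongrightarrow> lim x - x n"
    by (intro tendsto_diff tendsto_const LIMSEQ_ignore_initial_segment conv[unfolded convergent_LIMSEQ_iff])
  then have "norm (lim x - x n) \<le> 2 * sqrt S * (1/2) ^ n"
    by (rule Lim_norm_ubound[OF sequentially_bot]) (use bound in \<open>simp add: add.commute\<close>)
  then have "(norm (lim x - x n))\<^sup>2 \<le> (2 * sqrt S * (1/2) ^ n)\<^sup>2" by (intro power_mono) auto
  also have "\<dots> = 4 * S * (1/4) ^ n"
    using S0 by (simp add: power_mult_distrib half_power_square)
  finally show "(norm (x n - lim x))\<^sup>2 \<le> 4 * S * (1/4) ^ n" by (simp add: norm_minus_commute)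
qed

section \<open>The Wasserstein cost\<close>

lemma coupling_of_maps:
  fixes f g :: "'b \<Rightarrow> 'a::euclidean_space"
  assumes "prob_space M" and [measurable]: "f \<in> M \<rightarrow>\<^sub>M borel" "g \<in> M \<rightarrow>\<^sub>M borel"
  shows "distr M borel (\<lambda>x. (f x, g x)) \<in> couplings (distr M borel f) (distr M borel g)"
    and "cost2 (distr M borel (\<lambda>x. (f x, g x))) = (\<integral>\<^sup>+ x. ennreal ((norm (f x - g x))\<^sup>2) \<partial>M)"
proof -
  interpret prob_space M by fact
  have m: "(\<lambda>x. (f x, g x)) \<in> M \<rightarrow>\<^sub>M (borel :: ('a \<times> 'a) measure)"
    unfolding borel_prod[symmetric] by measurable
  have f1: "fst \<in> (borel :: ('a \<times> 'a) measure) \<rightarrow>\<^sub>M borel" and s1: "snd \<in> (borel :: ('a \<times> 'a) measure) \<rightarrow>\<^sub>M borel"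
    unfolding borel_prod[symmetric] by measurable
  show "distr M borel (\<lambda>x. (f x, g x)) \<in> couplings (distr M borel f) (distr M borel g)"
    using m f1 s1 by (auto simp: couplings_def distr_distr comp_def intro!: prob_space_distr)
  show "cost2 (distr M borel (\<lambda>x. (f x, g x))) = (\<integral>\<^sup>+ x. ennreal ((norm (f x - g x))\<^sup>2) \<partial>M)"
    using f1 s1 by (simp add: cost2_def nn_integral_distr[OF m])
qed

text \<open>Upper bounds on \<open>W2sq\<close> below come from exhibiting two random variables with
  the right laws on a common probability space.\<close>

lemma W2sq_le_maps:
  fixes f g :: "'b \<Rightarrow> 'a::euclidean_space"
  assumes "prob_space M" "f \<in> M \<rightarrow>\<^sub>M borel" "g \<in> M \<rightarrow>\<^sub>M borel"
  shows "W2sq (distr M borel f) (distr M borel g) \<le> (\<integral>\<^sup>+ x. ennreal ((norm (f x - g x))\<^sup>2) \<partial>M)"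
  unfolding W2sq_def coupling_of_maps(2)[OF assms, symmetric]
  by (rule INF_lower[OF coupling_of_maps(1)[OF assms]])

lemma measurable_borel_fst_snd:
  fixes \<gamma> :: "('a::euclidean_space \<times> 'a) measure"
  assumes "sets \<gamma> = sets borel"
  shows "fst \<in> \<gamma> \<rightarrow>\<^sub>M borel" "snd \<in> \<gamma> \<rightarrow>\<^sub>M borel"
  unfolding measurable_cong_sets[OF assms refl] borel_prod[symmetric] by measurable

lemma W2sq_sym: "W2sq \<mu> \<nu> = W2sq \<nu> \<mu>"
proof -
  have "W2sq \<mu> \<nu> \<le> W2sq \<nu> \<mu>" for \<mu> \<nu> :: "'a measure"
  proof -
    have "W2sq \<mu> \<nu> \<le> cost2 \<gamma>" if "\<gamma> \<in> couplings \<nu> \<mu>" for \<gamma>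
      using W2sq_le_maps[of \<gamma> snd fst] that measurable_borel_fst_snd[of \<gamma>]
      by (auto simp: couplings_def cost2_def norm_minus_commute)
    then show ?thesis unfolding W2sq_def[of \<nu> \<mu>] by (intro INF_greatest)
  qed
  then show ?thesis by (intro antisym)
qed

lemma distr_borel_id: "sets \<mu> = sets borel \<Longrightarrow> distr \<mu> borel (\<lambda>x. x) = \<mu>"
  by (simp add: distr_id2)

lemma W2sq_self:
  assumes "prob_space \<mu>" "sets \<mu> = sets borel" shows "W2sq \<mu> \<mu> = 0"
  using W2sq_le_maps[of \<mu> "\<lambda>x. x" "\<lambda>x. x"] assms distr_borel_id[OF assms(2)]
  by (simp add: measurable_ident_sets)

section \<open>Realisation on one probability space and completeness\<close>

text \<open>Puts all the measures on one probability space, where convergence can be studied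
  pointwise. The approximate kernels suffice: their marginals are exact and the cost grows only by a
  fixed factor and a summable error.\<close>

lemma glued_chain:
  fixes s :: "nat \<Rightarrow> 'a::euclidean_space measure"
  assumes s: "\<And>n. prob_space (s n)" "\<And>n. sets (s n) = sets borel"
    and \<gamma>: "\<And>n. \<gamma> n \<in> couplings (s n) (s (Suc n))"
  obtains M :: "(nat \<Rightarrow> 'a) measure" where "prob_space M"
    and "\<And>n. (\<lambda>\<omega>. \<omega> n) \<in> M \<rightarrow>\<^sub>M borel" and "\<And>n. distr M borel (\<lambda>\<omega>. \<omega> n) = s n"
    and "\<And>n. (\<integral>\<^sup>+ \<omega>. ennreal ((norm (\<omega> n - \<omega> (Suc n)))\<^sup>2) \<partial>M)
        \<le> ennreal (6 * (1/64) ^ n) + 4 * cost2 (\<gamma> n)"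
proof -
  define good where "good n K \<longleftrightarrow> K \<in> borel \<rightarrow>\<^sub>M subprob_algebra borel \<and> (\<forall>y. prob_space (K y)) \<and>
      (\<forall>g\<in>borel_measurable borel. (\<integral>\<^sup>+ y. (\<integral>\<^sup>+ z. g z \<partial>K y) \<partial>s n) = (\<integral>\<^sup>+ z. g z \<partial>s (Suc n))) \<and>
      (\<integral>\<^sup>+ y. (\<integral>\<^sup>+ z. ennreal ((norm (y - z))\<^sup>2) \<partial>K y) \<partial>s n) \<le> ennreal (6 * (1/64) ^ n) + 4 * cost2 (\<gamma> n)" for n K
  have "\<exists>K. good n K" for n
  proof -
    \<comment> \<open>The cell radius \<open>(1/8) ^ n\<close> makes the error
      \<open>6 * (1/64) ^ n\<close>, which still decays after weighting by
      \<open>4 ^ n\<close>.\<close>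
    have eps: "(((1/8) ^ n)\<^sup>2 :: real) = (1/64) ^ n" by (simp add: power2_eq_square flip: power_mult_distrib)
    show ?thesis
      by (rule approx_kernel[OF \<gamma>[of n], of "(1/8) ^ n"]) (auto simp: good_def eps)
  qed
  then obtain K where good: "\<And>n. good n (K n)" by metis
  have K[measurable]: "\<And>n. K n \<in> borel \<rightarrow>\<^sub>M subprob_algebra borel"
    and Kp: "\<And>n y. prob_space (K n y)"
    and Ks: "\<And>n g. g \<in> borel_measurable borel \<Longrightarrow>
      (\<integral>\<^sup>+ y. (\<integral>\<^sup>+ z. g z \<partial>K n y) \<partial>s n) = (\<integral>\<^sup>+ z. g z \<partial>s (Suc n))"
    and Kc: "\<And>n. (\<integral>\<^sup>+ y. (\<integral>\<^sup>+ z. ennreal ((norm (y - z))\<^sup>2) \<partial>K n y) \<partial>s n)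
      \<le> ennreal (6 * (1/64) ^ n) + 4 * cost2 (\<gamma> n)"
    using good unfolding good_def by blast+
  obtain M :: "(nat \<Rightarrow> 'a) measure" where M: "sets M = sets (PiM UNIV (\<lambda>_. borel))"
    and Mint: "\<And>n f. f \<in> borel_measurable (borel \<Otimes>\<^sub>M borel) \<Longrightarrow>
      (\<integral>\<^sup>+ \<omega>. f (\<omega> n, \<omega> (Suc n)) \<partial>M) = (\<integral>\<^sup>+ y. (\<integral>\<^sup>+ z. f (y, z) \<partial>K n y) \<partial>s n)"
    by (rule markov_chain_exists[of s K, OF s(1) s(2) K Kp]) (erule Ks, rule that)
  have comp: "(\<lambda>\<omega>. \<omega> n) \<in> M \<rightarrow>\<^sub>M borel" for n
    unfolding measurable_cong_sets[OF M refl] by (rule measurable_component_singleton) simp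
  have law: "(\<integral>\<^sup>+ \<omega>. g (\<omega> n) \<partial>M) = (\<integral>\<^sup>+ y. g y \<partial>s n)" if [measurable]: "g \<in> borel_measurable borel" for g n
    using Mint[of "\<lambda>p. g (fst p)" n] by (simp add: prob_space.emeasure_space_1[OF Kp])
  show thesis
  proof
    have "emeasure M (space M) = 1"
      using law[of "\<lambda>_. 1" 0] prob_space.emeasure_space_1[OF s(1)] by simp
    then show "prob_space M" by (rule prob_spaceI)
    show "distr M borel (\<lambda>\<omega>. \<omega> n) = s n" for n
    proof (rule measure_eqI)
      fix A assume "A \<in> sets (distr M borel (\<lambda>\<omega>. \<omega> n))"
      then have A: "A \<in> sets borel" by simp
      have "emeasure (distr M borel (\<lambda>\<omega>. \<omega> n)) A = (\<integral>\<^sup>+ \<omega>. indicator A (\<omega> n) \<partial>M)"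
        using A nn_integral_distr[OF comp[of n], of "indicator A"] by simp
      also have "\<dots> = emeasure (s n) A" using law[of "indicator A" n] A s(2) by simp
      finally show "emeasure (distr M borel (\<lambda>\<omega>. \<omega> n)) A = emeasure (s n) A" .
    qed (simp add: s)
    show "(\<integral>\<^sup>+ \<omega>. ennreal ((norm (\<omega> n - \<omega> (Suc n)))\<^sup>2) \<partial>M)
        \<le> ennreal (6 * (1/64) ^ n) + 4 * cost2 (\<gamma> n)" for n
      using Mint[of "\<lambda>p. ennreal ((norm (fst p - snd p))\<^sup>2)" n] Kc[of n] by simp
  qed (rule comp)
qed

text \<open>Only finiteness is at stake, so the constants lost in gluing do no harm; the sharp
  triangle inequality is derived later from transport plans.\<close>

lemma W2sq_finite_trans:
  fixes \<mu> \<nu> \<rho> :: "'a::euclidean_space measure"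
  assumes "W2sq \<mu> \<nu> < \<infinity>" "W2sq \<nu> \<rho> < \<infinity>"
  shows "W2sq \<mu> \<rho> < \<infinity>"
proof -
  obtain \<gamma>1 \<gamma>2 where \<gamma>1: "\<gamma>1 \<in> couplings \<mu> \<nu>" "cost2 \<gamma>1 < \<infinity>" and \<gamma>2: "\<gamma>2 \<in> couplings \<nu> \<rho>" "cost2 \<gamma>2 < \<infinity>"
    using assms unfolding W2sq_def INF_less_iff by blast
  have p: "prob_space \<mu>" "prob_space \<nu>" "prob_space \<rho>" "sets \<mu> = sets borel" "sets \<nu> = sets borel" "sets \<rho> = sets borel"
    using \<gamma>1 \<gamma>2 measurable_borel_fst_snd[of \<gamma>1] measurable_borel_fst_snd[of \<gamma>2]
    by (auto simp: couplings_def intro!: prob_space.prob_space_distr)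
  \<comment> \<open>To fit an infinite chain, the three measures are continued by the constant
    \<rho>, joined by diagonal couplings.\<close>
  define s where "s n = (if n = 0 then \<mu> else if n = 1 then \<nu> else \<rho>)" for n :: nat
  have sp: "prob_space (s n)" "sets (s n) = sets borel" for n using p by (auto simp: s_def)
  define \<gamma> where "\<gamma> n = (if n = 0 then \<gamma>1 else if n = 1 then \<gamma>2 else distr \<rho> borel (\<lambda>x. (x, x)))" for n :: nat
  have "distr \<rho> borel (\<lambda>x. (x, x)) \<in> couplings \<rho> \<rho>"
    using coupling_of_maps(1)[of \<rho> "\<lambda>x. x" "\<lambda>x. x"] p distr_borel_id[of \<rho>] by (simp add: measurable_ident_sets)
  then have \<gamma>: "\<gamma> n \<in> couplings (s n) (s (Suc n))" for n
    using \<gamma>1 \<gamma>2 by (simp add: \<gamma>_def s_def)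
  obtain M :: "(nat \<Rightarrow> 'a) measure" where M: "prob_space M"
    and comp[measurable]: "\<And>n. (\<lambda>\<omega>. \<omega> n) \<in> M \<rightarrow>\<^sub>M borel" and law: "\<And>n. distr M borel (\<lambda>\<omega>. \<omega> n) = s n"
    and c: "\<And>n. (\<integral>\<^sup>+ \<omega>. ennreal ((norm (\<omega> n - \<omega> (Suc n)))\<^sup>2) \<partial>M)
        \<le> ennreal (6 * (1/64) ^ n) + 4 * cost2 (\<gamma> n)"
    by (rule glued_chain[of s \<gamma>, OF sp \<gamma>]) (rule that)
  have fin: "(\<integral>\<^sup>+ \<omega>. ennreal ((norm (\<omega> n - \<omega> (Suc n)))\<^sup>2) \<partial>M) < \<infinity>" if "n < 2" for n
    using that \<gamma>1(2) \<gamma>2(2) by (intro le_less_trans[OF c]) (auto simp: \<gamma>_def ennreal_mult_less_top less_top)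
  have "W2sq \<mu> \<rho> \<le> (\<integral>\<^sup>+ \<omega>. ennreal ((norm (\<omega> 0 - \<omega> 2))\<^sup>2) \<partial>M)"
    using W2sq_le_maps[OF M comp[of 0] comp[of 2]] by (simp add: law s_def)
  also have "\<dots> \<le> (\<integral>\<^sup>+ \<omega>. 2 * ennreal ((norm (\<omega> 0 - \<omega> 1))\<^sup>2) + 2 * ennreal ((norm (\<omega> 1 - \<omega> 2))\<^sup>2) \<partial>M)"
  proof (intro nn_integral_mono)
    fix \<omega> :: "nat \<Rightarrow> 'a"
    have "ennreal ((norm (\<omega> 0 - \<omega> 2))\<^sup>2) \<le> ennreal (2 * (norm (\<omega> 0 - \<omega> 1))\<^sup>2 + 2 * (norm (\<omega> 1 - \<omega> 2))\<^sup>2)"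
      by (intro ennreal_leI norm_diff_square_le)
    then show "ennreal ((norm (\<omega> 0 - \<omega> 2))\<^sup>2)
        \<le> 2 * ennreal ((norm (\<omega> 0 - \<omega> 1))\<^sup>2) + 2 * ennreal ((norm (\<omega> 1 - \<omega> 2))\<^sup>2)"
      by (simp add: ennreal_mult)
  qed
  also have "\<dots> = 2 * (\<integral>\<^sup>+ \<omega>. ennreal ((norm (\<omega> 0 - \<omega> 1))\<^sup>2) \<partial>M) + 2 * (\<integral>\<^sup>+ \<omega>. ennreal ((norm (\<omega> 1 - \<omega> 2))\<^sup>2) \<partial>M)"
    by (simp add: nn_integral_add nn_integral_cmult)
  also have "\<dots> < \<infinity>"
    using fin[of 0] fin[of 1] by (auto simp: ennreal_mult_less_top numeral_2_eq_2 less_top)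
  finally show ?thesis .
qed

text \<open>On the glued chain the weighted sum of squared increments has finite mean, so the
  coordinates converge almost surely. The limit measure is the law of the pointwise limit, and
  integrating the pointwise rate gives the rate in \<open>W2sq\<close>.\<close>

lemma W2sq_complete:
  fixes s :: "nat \<Rightarrow> 'a::euclidean_space measure"
  assumes s: "\<And>n. prob_space (s n)" "\<And>n. sets (s n) = sets borel"
    and c: "\<And>n. W2sq (s n) (s (Suc n)) \<le> ennreal ((1/8) ^ n)"
  obtains l C where "prob_space l" "sets l = sets borel" "0 \<le> C"
    and "\<And>n. W2sq (s n) l \<le> ennreal (C * (1/4) ^ n)"
proof -
  \<comment> \<open>The factor 2 puts the bound strictly above the infimum, so some coupling stays
    below it.\<close>
  have "\<exists>\<gamma>\<in>couplings (s n) (s (Suc n)). cost2 \<gamma> < ennreal (2 * (1/8) ^ n)" for n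
    unfolding INF_less_iff[symmetric] W2sq_def[symmetric]
    by (rule le_less_trans[OF c]) (simp add: ennreal_less_iff)
  then obtain \<gamma> where \<gamma>: "\<And>n. \<gamma> n \<in> couplings (s n) (s (Suc n))"
    and \<gamma>c: "\<And>n. cost2 (\<gamma> n) < ennreal (2 * (1/8) ^ n)" by metis
  obtain M :: "(nat \<Rightarrow> 'a) measure" where M: "prob_space M"
    and comp[measurable]: "\<And>n. (\<lambda>\<omega>. \<omega> n) \<in> M \<rightarrow>\<^sub>M borel" and law: "\<And>n. distr M borel (\<lambda>\<omega>. \<omega> n) = s n"
    and Mc: "\<And>n. (\<integral>\<^sup>+ \<omega>. ennreal ((norm (\<omega> n - \<omega> (Suc n)))\<^sup>2) \<partial>M)
        \<le> ennreal (6 * (1/64) ^ n) + 4 * cost2 (\<gamma> n)"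
    by (rule glued_chain[of s \<gamma>, OF s \<gamma>]) (rule that)
  interpret prob_space M by fact
  have Mc': "(\<integral>\<^sup>+ \<omega>. ennreal ((norm (\<omega> n - \<omega> (Suc n)))\<^sup>2) \<partial>M) \<le> ennreal (14 * (1/8) ^ n)" for n
  proof -
    have "(1/64 :: real) ^ n \<le> (1/8) ^ n" by (intro power_mono) auto
    have "ennreal (6 * (1/64) ^ n) + 4 * cost2 (\<gamma> n) \<le> ennreal (6 * (1/8) ^ n) + 4 * ennreal (2 * (1/8) ^ n)"
      using \<gamma>c[of n] \<open>(1/64 :: real) ^ n \<le> (1/8) ^ n\<close>
      by (intro add_mono mult_left_mono ennreal_leI) (auto simp: less_imp_le)
    also have "\<dots> = ennreal (6 * (1/8) ^ n) + ennreal (4 * (2 * (1/8) ^ n))"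
      by (subst ennreal_mult[of 4]) auto
    also have "\<dots> = ennreal (14 * (1/8) ^ n)" by (subst ennreal_plus[symmetric]) auto
    finally show ?thesis using Mc[of n] by (rule order_trans[rotated])
  qed
  \<comment> \<open>The weight \<open>4 ^ k\<close> turns the bound \<open>14 * (1/8) ^ k\<close>
    into the summable \<open>14 * (1/2) ^ k\<close> and still forces geometric decay of the
    increments wherever \<open>S\<close> is finite.\<close>
  define S where "S \<omega> = (\<Sum>k. ennreal (4 ^ k) * ennreal ((norm (\<omega> k - \<omega> (Suc k)))\<^sup>2))" for \<omega> :: "nat \<Rightarrow> 'a"
  have [measurable]: "S \<in> borel_measurable M" unfolding S_def by measurable
  have "(\<integral>\<^sup>+ \<omega>. S \<omega> \<partial>M) = (\<Sum>k. ennreal (4 ^ k) * (\<integral>\<^sup>+ \<omega>. ennreal ((norm (\<omega> k - \<omega> (Suc k)))\<^sup>2) \<partial>M))"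
    unfolding S_def by (subst nn_integral_suminf) (auto simp: nn_integral_cmult)
  also have "\<dots> \<le> (\<Sum>k. ennreal (14 * (1/2) ^ k))"
  proof (intro suminf_le summableI)
    fix k
    have "ennreal (4 ^ k) * (\<integral>\<^sup>+ \<omega>. ennreal ((norm (\<omega> k - \<omega> (Suc k)))\<^sup>2) \<partial>M)
        \<le> ennreal (4 ^ k) * ennreal (14 * (1/8) ^ k)" by (intro mult_left_mono Mc') simp
    also have "\<dots> = ennreal (14 * (4 ^ k * (1/8) ^ k))" by (subst ennreal_mult[symmetric]) (auto simp: mult_ac)
    also have "(4 ^ k * (1/8) ^ k :: real) = (1/2) ^ k" by (simp flip: power_mult_distrib)
    finally show "ennreal (4 ^ k) * (\<integral>\<^sup>+ \<omega>. ennreal ((norm (\<omega> k - \<omega> (Suc k)))\<^sup>2) \<partial>M)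
        \<le> ennreal (14 * (1/2) ^ k)" .
  qed
  also have "\<dots> = ennreal (\<Sum>k. 14 * (1/2) ^ k)"
    by (intro suminf_ennreal2 summable_mult summable_geometric) auto
  also have "\<dots> < \<infinity>" by simp
  finally have S_fin: "(\<integral>\<^sup>+ \<omega>. S \<omega> \<partial>M) < \<infinity>" .
  then have AE_S: "AE \<omega> in M. S \<omega> \<noteq> \<infinity>" by (intro nn_integral_noteq_infinite) auto
  \<comment> \<open>\<open>lim\<close> is total; sequences where its value is arbitrary lie in the
    null set where \<open>S\<close> is infinite.\<close>
  define X where "X \<omega> = lim (\<lambda>n. \<omega> n)" for \<omega> :: "nat \<Rightarrow> 'a"
  have Xm: "X \<in> M \<rightarrow>\<^sub>M borel" unfolding X_def by measurable
  have dist: "ennreal ((norm (\<omega> n - X \<omega>))\<^sup>2) \<le> ennreal (4 * (1/4) ^ n) * S \<omega>" if fin: "S \<omega> \<noteq> \<infinity>" for \<omega> n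
  proof -
    obtain r where r: "0 \<le> r" "S \<omega> = ennreal r" using fin by (cases "S \<omega>") auto
    have "4 ^ k * (norm (\<omega> k - \<omega> (Suc k)))\<^sup>2 \<le> r" for k
    proof -
      have "ennreal (4 ^ k) * ennreal ((norm (\<omega> k - \<omega> (Suc k)))\<^sup>2) \<le> S \<omega>"
        unfolding S_def using sum_le_suminf[OF summableI, of "{k}"
            "\<lambda>k. ennreal (4 ^ k) * ennreal ((norm (\<omega> k - \<omega> (Suc k)))\<^sup>2)"] by simp
      then have "ennreal (4 ^ k * (norm (\<omega> k - \<omega> (Suc k)))\<^sup>2) \<le> ennreal r"
        by (simp only: r ennreal_mult[symmetric] zero_le_power2 zero_le_power zero_le_numeral)
      then show ?thesis using r by simp
    qed
    from weighted_increments_limit(2)[OF this, of n]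
    have "ennreal ((norm (\<omega> n - X \<omega>))\<^sup>2) \<le> ennreal (4 * (1/4) ^ n * r)"
      unfolding X_def by (intro ennreal_leI) (simp add: mult_ac)
    also have "\<dots> = ennreal (4 * (1/4) ^ n) * S \<omega>" using r by (simp add: ennreal_mult)
    finally show ?thesis .
  qed
  obtain C where C: "0 \<le> C" "(\<integral>\<^sup>+ \<omega>. S \<omega> \<partial>M) = ennreal C" using S_fin by (cases "\<integral>\<^sup>+ \<omega>. S \<omega> \<partial>M") auto
  show thesis
  proof
    show "prob_space (distr M borel X)" by (rule prob_space_distr[OF Xm])
    show "0 \<le> 4 * C" using C by simp
    fix n
    have "W2sq (s n) (distr M borel X) \<le> (\<integral>\<^sup>+ \<omega>. ennreal ((norm (\<omega> n - X \<omega>))\<^sup>2) \<partial>M)"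
      using W2sq_le_maps[OF M comp[of n] Xm] by (simp add: law)
    also have "\<dots> \<le> (\<integral>\<^sup>+ \<omega>. ennreal (4 * (1/4) ^ n) * S \<omega> \<partial>M)"
      by (rule nn_integral_mono_AE) (use AE_S dist in auto)
    also have "\<dots> = ennreal (4 * (1/4) ^ n) * ennreal C" by (simp add: nn_integral_cmult C)
    also have "\<dots> = ennreal (4 * C * (1/4) ^ n)"
      using C by (subst ennreal_mult[symmetric]) (auto simp: mult_ac)
    finally show "W2sq (s n) (distr M borel X) \<le> ennreal (4 * C * (1/4) ^ n)" .
  qed simp
qed

section \<open>Resolvents in a metric setting\<close>

text \<open>Weighted Cauchy-Schwarz, \<open>(d + e)\<^sup>2 \<le> (1 / S + 1 / T) * (S * d\<^sup>2 +
  T * e\<^sup>2)\<close>, where \<open>S\<close> and \<open>T\<close> are the coefficients on the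
  right-hand side of the claim. What remains is
  \<open>x * (th - x) * (1 / S + 1 / T) \<le> 1\<close>.\<close>

lemma absorb_surplus:
  fixes x th D d e :: real
  assumes "0 \<le> x" "x < th" "th \<le> 1" "x < 1" "0 \<le> d" "0 \<le> e" "0 \<le> D" "D \<le> d + e"
  shows "x * (th - x) * D\<^sup>2 \<le> (th\<^sup>2 / (th - x) - (1 - x) * th) * d\<^sup>2 + (1 - x) * th * e\<^sup>2"
proof -
  define u where "u = th - x"
  define S where "S = th * x * (1 + u) / u"
  define T where "T = (1 - x) * th"
  have u: "0 < u" "u \<le> 1 - x" "th = u + x" using assms by (auto simp: u_def)
  have S: "th\<^sup>2 / (th - x) - (1 - x) * th = S"
    using u by (simp add: S_def u_def[symmetric] field_simps power2_eq_square)
  show ?thesis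
  \<comment> \<open>For \<open>x = 0\<close> both the left-hand side and \<open>S\<close> vanish,
    and dividing by \<open>S\<close> makes no sense.\<close>
  proof (cases "x = 0")
    case True
    then show ?thesis using assms by (simp add: power2_eq_square)
  next
    case False
    then have x: "0 < x" using assms by simp
    have th: "0 < th" using assms by simp
    have S0: "0 < S" using x th u by (simp add: S_def)
    have T0: "0 < T" using th assms by (simp add: T_def)
    have "x * u * (1 / S) = u * (u / (1 + u)) / th"
      using x th by (simp add: S_def)
    moreover have "x * u * (1 / T) = x * (u / (1 - x)) / th"
      by (simp add: T_def)
    ultimately have "x * u * (1 / S + 1 / T) = (u * (u / (1 + u)) + x * (u / (1 - x))) / th"
      by (simp add: distrib_left add_divide_distrib)
    \<comment> \<open>Both inner fractions are at most 1, the second because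
      \<open>th \<le> 1\<close> gives \<open>u \<le> 1 - x\<close>.\<close>
    also have "\<dots> \<le> (u * 1 + x * 1) / th"
      using x th u assms by (intro divide_right_mono add_mono mult_left_mono) (auto simp: field_simps)
    also have "\<dots> = 1" using u th by simp
    finally have k: "x * u * (1 / S + 1 / T) \<le> 1" .
    have "(S + T) * (S * d\<^sup>2 + T * e\<^sup>2) - S * T * (d + e)\<^sup>2 = (S * d - T * e)\<^sup>2"
      by (simp add: power2_eq_square algebra_simps)
    then have "S * T * (d + e)\<^sup>2 \<le> (S + T) * (S * d\<^sup>2 + T * e\<^sup>2)"
      using zero_le_power2[of "S * d - T * e"] by linarith
    then have c: "(d + e)\<^sup>2 \<le> (1 / S + 1 / T) * (S * d\<^sup>2 + T * e\<^sup>2)"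
      using S0 T0 by (simp add: field_simps)
    have "x * u * D\<^sup>2 \<le> x * u * (d + e)\<^sup>2"
      using x u assms by (intro mult_left_mono power_mono) auto
    also have "\<dots> \<le> x * u * ((1 / S + 1 / T) * (S * d\<^sup>2 + T * e\<^sup>2))"
      using x u by (intro mult_left_mono c) auto
    also have "\<dots> = (x * u * (1 / S + 1 / T)) * (S * d\<^sup>2 + T * e\<^sup>2)" by (simp only: mult.assoc)
    also have "\<dots> \<le> 1 * (S * d\<^sup>2 + T * e\<^sup>2)"
      using k S0 T0 by (intro mult_right_mono) auto
    finally show ?thesis unfolding S unfolding T_def[symmetric] u_def[symmetric] by simp
  qed
qed

section \<open>Metric spaces with a convex functional\<close>

text \<open>Collects what the estimates use of \<open>P2\<close>, \<open>W2\<close> and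
  \<open>E\<close>. \<open>L\<close> stands for the negative part of \<lambda>, and \<open>D\<close>
  for the squared cost of a transport plan, which may exceed \<open>(W x y)\<^sup>2\<close>. The
  same curve and the same \<open>D\<close> occur in the bounds for the distance and for
  \<open>E\<close>, so that the two can be added.\<close>

locale evi_space =
  fixes P :: "'m set" and W :: "'m \<Rightarrow> 'm \<Rightarrow> real" and E :: "'m \<Rightarrow> ereal" and L :: real
  assumes W_nonneg: "0 \<le> W x y"
    and W_refl: "x \<in> P \<Longrightarrow> W x x = 0"
    and W_sym: "W x y = W y x"
    and W_triangle: "\<lbrakk>x \<in> P; y \<in> P; z \<in> P\<rbrakk> \<Longrightarrow> W x z \<le> W x y + W y z"
    and W_complete: "\<lbrakk>\<And>n. s n \<in> P; \<And>n. (W (s n) (s (Suc n)))\<^sup>2 \<le> (1/8) ^ n\<rbrakk>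
      \<Longrightarrow> \<exists>l\<in>P. (\<lambda>n. W (s n) l) \<longlonglongrightarrow> 0"
    and E_lsc: "\<lbrakk>x \<in> P; \<And>n. s n \<in> P; (\<lambda>n. W (s n) x) \<longlonglongrightarrow> 0\<rbrakk> \<Longrightarrow> E x \<le> liminf (\<lambda>n. E (s n))"
    and E_not_minfty: "x \<in> P \<Longrightarrow> E x \<noteq> - \<infinity>"
    and L_nonneg: "0 \<le> L"
    and E_convex: "\<lbrakk>w \<in> P; x \<in> P; y \<in> P\<rbrakk> \<Longrightarrow> \<exists>g D. (W x y)\<^sup>2 \<le> D \<and> (\<forall>a\<in>{0..1}. g a \<in> P \<and>
      (W w (g a))\<^sup>2 \<le> (1 - a) * (W w x)\<^sup>2 + a * (W w y)\<^sup>2 - a * (1 - a) * D \<and>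
      E (g a) \<le> ereal (1 - a) * E x + ereal a * E y + ereal (a * (1 - a) * (L / 2) * D))"
begin

declare abs_real_of_ereal [simp del]

definition fin_dom :: "'m set" where "fin_dom = {x \<in> P. E x < \<infinity>}"

definition fin_E :: "'m \<Rightarrow> real" where "fin_E x = real_of_ereal (E x)"

definition is_minimizer :: "real \<Rightarrow> 'm \<Rightarrow> 'm \<Rightarrow> bool" where
  "is_minimizer t w x \<longleftrightarrow> x \<in> P \<and>
     (\<forall>y\<in>P. ereal ((W w x)\<^sup>2 / (2 * t)) + E x \<le> ereal ((W w y)\<^sup>2 / (2 * t)) + E y)"

lemma fin_dom_subset: "x \<in> fin_dom \<Longrightarrow> x \<in> P"
  by (simp add: fin_dom_def)

lemma E_fin_dom: "x \<in> fin_dom \<Longrightarrow> E x = ereal (fin_E x)"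
  using E_not_minfty[of x] by (cases "E x") (auto simp: fin_dom_def fin_E_def)

lemma convex_fin_dom:
  assumes "w \<in> P" "x \<in> fin_dom" "y \<in> fin_dom"
  obtains g D where "(W x y)\<^sup>2 \<le> D"
    and "\<And>a. 0 \<le> a \<Longrightarrow> a \<le> 1 \<Longrightarrow> g a \<in> fin_dom"
    and "\<And>a. 0 \<le> a \<Longrightarrow> a \<le> 1 \<Longrightarrow>
      (W w (g a))\<^sup>2 \<le> (1 - a) * (W w x)\<^sup>2 + a * (W w y)\<^sup>2 - a * (1 - a) * D"
    and "\<And>a. 0 \<le> a \<Longrightarrow> a \<le> 1 \<Longrightarrow>
      fin_E (g a) \<le> (1 - a) * fin_E x + a * fin_E y + a * (1 - a) * (L / 2) * D"
proof -
  obtain g D where D: "(W x y)\<^sup>2 \<le> D" and g: "\<And>a. 0 \<le> a \<Longrightarrow> a \<le> 1 \<Longrightarrow> g a \<in> P \<and>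
      (W w (g a))\<^sup>2 \<le> (1 - a) * (W w x)\<^sup>2 + a * (W w y)\<^sup>2 - a * (1 - a) * D \<and>
      E (g a) \<le> ereal (1 - a) * E x + ereal a * E y + ereal (a * (1 - a) * (L / 2) * D)"
    using E_convex[OF assms(1) assms(2,3)[THEN fin_dom_subset]] by (metis atLeastAtMost_iff)
  have E: "E (g a) \<le> ereal ((1 - a) * fin_E x + a * fin_E y + a * (1 - a) * (L / 2) * D)"
    if "0 \<le> a" "a \<le> 1" for a
    using g[OF that] by (simp add: E_fin_dom assms)
  have dom: "g a \<in> fin_dom" if "0 \<le> a" "a \<le> 1" for a
    using E[OF that] g[OF that] by (auto simp: fin_dom_def dest: le_less_trans)
  have "fin_E (g a) \<le> (1 - a) * fin_E x + a * fin_E y + a * (1 - a) * (L / 2) * D"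
    if "0 \<le> a" "a \<le> 1" for a
    using E[OF that] E_fin_dom[OF dom[OF that]] by simp
  with D dom g show thesis by (intro that[of D g]) auto
qed

text \<open>With base point \<open>x\<close> the comparison \<open>0 \<le> W x (g a)\<^sup>2\<close> as \<open>a \<longrightarrow> 0\<close> forces \<open>D = W x y\<^sup>2\<close>.\<close>

lemma convex_from_base:
  assumes "x \<in> fin_dom" "y \<in> fin_dom"
  obtains g where "\<And>a. 0 \<le> a \<Longrightarrow> a \<le> 1 \<Longrightarrow> g a \<in> fin_dom"
    and "\<And>a. 0 \<le> a \<Longrightarrow> a \<le> 1 \<Longrightarrow> W x (g a) \<le> a * W x y"
    and "\<And>a. 0 \<le> a \<Longrightarrow> a \<le> 1 \<Longrightarrow>
      fin_E (g a) \<le> (1 - a) * fin_E x + a * fin_E y + a * (1 - a) * (L / 2) * (W x y)\<^sup>2"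
proof -
  obtain g D where D: "(W x y)\<^sup>2 \<le> D"
    and g: "\<And>a. 0 \<le> a \<Longrightarrow> a \<le> 1 \<Longrightarrow> g a \<in> fin_dom"
      "\<And>a. 0 \<le> a \<Longrightarrow> a \<le> 1 \<Longrightarrow>
      (W x (g a))\<^sup>2 \<le> (1 - a) * (W x x)\<^sup>2 + a * (W x y)\<^sup>2 - a * (1 - a) * D"
      "\<And>a. 0 \<le> a \<Longrightarrow> a \<le> 1 \<Longrightarrow>
      fin_E (g a) \<le> (1 - a) * fin_E x + a * fin_E y + a * (1 - a) * (L / 2) * D"
    using convex_fin_dom[OF fin_dom_subset[OF assms(1)] assms] by metis
  have x: "W x x = 0" using W_refl fin_dom_subset assms by auto
  have "D \<le> (W x y)\<^sup>2"
  proof (rule field_le_mult_one_interval)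
    fix z :: real assume z: "0 < z" "z < 1"
    have "0 \<le> (1 - z) * ((W x y)\<^sup>2 - z * D)"
      using order_trans[OF zero_le_power2 g(2)[of "1 - z"]] z x by (simp add: algebra_simps)
    then show "z * D \<le> (W x y)\<^sup>2" using z by (simp add: zero_le_mult_iff)
  qed
  with D have D: "D = (W x y)\<^sup>2" by simp
  have "W x (g a) \<le> a * W x y" if "0 \<le> a" "a \<le> 1" for a
  proof (rule power2_le_imp_le)
    show "(W x (g a))\<^sup>2 \<le> (a * W x y)\<^sup>2"
      using g(2)[OF that] by (simp add: x D power2_eq_square algebra_simps)
  qed (use that W_nonneg in simp)
  with g D show thesis by (intro that[of g]) auto
qed

lemma minimizer_fin_dom:
  assumes "is_minimizer t w x" "w \<in> fin_dom"
  shows "x \<in> fin_dom"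
proof -
  have "ereal ((W w x)\<^sup>2 / (2 * t)) + E x \<le> ereal ((W w w)\<^sup>2 / (2 * t)) + E w"
    using assms by (auto simp: is_minimizer_def fin_dom_def)
  then show ?thesis using assms(1) E_fin_dom[OF assms(2)]
    by (cases "E x") (auto simp: is_minimizer_def fin_dom_def)
qed

section \<open>The discrete variational inequality\<close>

text \<open>The minimizer \<open>x\<close> is compared with points \<open>g a\<close> on the curve
  from \<open>x\<close> to \<open>y\<close> with base \<open>w\<close>. Dividing by \<open>a\<close>
  and letting \<open>a\<close> tend to 0 gives the inequality with \<open>D\<close>, and
  \<open>1 - L * t > 0\<close> allows \<open>D\<close> to be lowered to
  \<open>(W x y)\<^sup>2\<close>.\<close>

lemma evi:
  assumes J: "is_minimizer t w x" and w: "w \<in> P" and x: "x \<in> fin_dom" and y: "y \<in> fin_dom"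
    and t: "0 < t" "L * t < 1"
  shows "(1 - L * t) * (W x y)\<^sup>2 - (W w y)\<^sup>2 \<le> 2 * t * (fin_E y - fin_E x) - (W w x)\<^sup>2"
proof -
  obtain g D where D: "(W x y)\<^sup>2 \<le> D"
    and g: "\<And>a. 0 \<le> a \<Longrightarrow> a \<le> 1 \<Longrightarrow> g a \<in> fin_dom"
      "\<And>a. 0 \<le> a \<Longrightarrow> a \<le> 1 \<Longrightarrow>
      (W w (g a))\<^sup>2 \<le> (1 - a) * (W w x)\<^sup>2 + a * (W w y)\<^sup>2 - a * (1 - a) * D"
      "\<And>a. 0 \<le> a \<Longrightarrow> a \<le> 1 \<Longrightarrow>
      fin_E (g a) \<le> (1 - a) * fin_E x + a * fin_E y + a * (1 - a) * (L / 2) * D"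
    using convex_fin_dom[OF w x y] by metis
  have "(1 - L * t) * D \<le> 2 * t * (fin_E y - fin_E x) - (W w x)\<^sup>2 + (W w y)\<^sup>2" (is "_ \<le> ?R")
  \<comment> \<open>With \<open>z = 1 - a\<close> this rule carries out the limit of
    \<open>a\<close> to 0.\<close>
  proof (rule field_le_mult_one_interval)
    fix z :: real assume z: "0 < z" "z < 1"
    define a where "a = 1 - z"
    have a: "0 < a" "a \<le> 1" using z by (auto simp: a_def)
    have "ereal ((W w x)\<^sup>2 / (2 * t)) + E x \<le> ereal ((W w (g a))\<^sup>2 / (2 * t)) + E (g a)"
      using J g(1)[of a] a by (auto simp: is_minimizer_def fin_dom_def)
    then have "(W w x)\<^sup>2 / (2 * t) + fin_E x \<le> (W w (g a))\<^sup>2 / (2 * t) + fin_E (g a)"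
      using E_fin_dom[OF x] E_fin_dom[OF g(1)[of a]] a by simp
    then have "(2 * t) * ((W w x)\<^sup>2 / (2 * t) + fin_E x) \<le> (2 * t) * ((W w (g a))\<^sup>2 / (2 * t) + fin_E (g a))"
      using t by (intro mult_left_mono) auto
    then have "(W w x)\<^sup>2 + 2 * t * fin_E x \<le> (W w (g a))\<^sup>2 + 2 * t * fin_E (g a)"
      using t by (simp add: distrib_left)
    also have "\<dots> \<le> (1 - a) * (W w x)\<^sup>2 + a * (W w y)\<^sup>2 - a * (1 - a) * D
       + 2 * t * ((1 - a) * fin_E x + a * fin_E y + a * (1 - a) * (L / 2) * D)"
      using g(2,3)[of a] a t by (intro add_mono mult_left_mono) auto
    finally have "0 \<le> a * (?R - z * ((1 - L * t) * D))"
      by (simp add: a_def field_simps)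
    then show "z * ((1 - L * t) * D) \<le> ?R" using a by (simp add: zero_le_mult_iff)
  qed
  moreover have "(1 - L * t) * (W x y)\<^sup>2 \<le> (1 - L * t) * D"
    using D t by (intro mult_left_mono) auto
  ultimately show ?thesis by simp
qed

section \<open>The slope of a convex functional\<close>

text \<open>The constant sequence \<open>y\<close> converges to \<open>x\<close>, so lower
  semicontinuity applies to it.\<close>

lemma E_le_of_W_eq_0:
  assumes "x \<in> P" "y \<in> P" "W x y = 0" shows "E x \<le> E y"
  using E_lsc[of x "\<lambda>_. y"] assms by (simp add: W_sym[of y] Liminf_const)

text \<open>Repeats \<open>slope\<close> with \<open>P\<close> and \<open>W\<close> in place of
  \<open>P2 \<omega>0\<close> and \<open>W2\<close>; in the Wasserstein instance the two agree by
  unfolding.\<close>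

definition E_slope :: "'m \<Rightarrow> ereal" where
  "E_slope x = (INF r\<in>{0<..}. SUP y\<in>{y\<in>P. 0 < W x y \<and> W x y < r}.
      max 0 (E x - E y) / ereal (W x y))"

text \<open>Convexity makes the local slope control the drop at any distance: along the curve from
  \<open>x\<close> to \<open>y\<close> the energy falls per unit of distance by at least
  \<open>q / d\<close>, also arbitrarily close to \<open>x\<close>, so this quotient is a lower
  bound for the slope when \<open>q\<close> is positive.\<close>

lemma slope_estimate:
  assumes x: "x \<in> fin_dom" and y: "y \<in> fin_dom" and fin: "E_slope x < \<infinity>"
  shows "fin_E x - fin_E y \<le> \<bar>real_of_ereal (E_slope x)\<bar> * W x y + (L / 2) * (W x y)\<^sup>2"
proof -
  define d where "d = W x y"
  have d0: "0 \<le> d" by (simp add: d_def W_nonneg)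
  obtain g where g: "\<And>a. 0 \<le> a \<Longrightarrow> a \<le> 1 \<Longrightarrow> g a \<in> fin_dom"
    "\<And>a. 0 \<le> a \<Longrightarrow> a \<le> 1 \<Longrightarrow> W x (g a) \<le> a * d"
    "\<And>a. 0 \<le> a \<Longrightarrow> a \<le> 1 \<Longrightarrow>
      fin_E (g a) \<le> (1 - a) * fin_E x + a * fin_E y + a * (1 - a) * (L / 2) * d\<^sup>2"
    using convex_from_base[OF x y] unfolding d_def by metis
  \<comment> \<open>Convexity guarantees the drop \<open>a * q\<close> at \<open>g a\<close>; the
    extra term with \<open>a * a\<close> is nonnegative and is discarded.\<close>
  define q where "q = fin_E x - fin_E y - (L / 2) * d\<^sup>2"
  have q: "a * q \<le> fin_E x - fin_E (g a)" if "0 < a" "a \<le> 1" for a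
  proof -
    have "a * a * (L / 2) * d\<^sup>2 \<ge> 0" using L_nonneg by simp
    then show ?thesis using g(3)[of a] that by (simp add: q_def field_simps)
  qed
  show ?thesis
  proof (cases "q \<le> 0")
    case True
    moreover have "0 \<le> \<bar>real_of_ereal (E_slope x)\<bar> * d" using d0 by simp
    ultimately show ?thesis unfolding d_def[symmetric] q_def by linarith
  next
    case False
    \<comment> \<open>The supremum in the slope runs over positive distances only; at distance zero
      the energy could not drop, against \<open>q > 0\<close>.\<close>
    have pos: "0 < W x (g a)" if "0 < a" "a \<le> 1" for a
    proof (rule ccontr)
      assume "\<not> 0 < W x (g a)"
      then have "W x (g a) = 0" using W_nonneg[of x "g a"] by simp
      then have "E x \<le> E (g a)"
        using E_le_of_W_eq_0 x g(1)[of a] that fin_dom_subset by auto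
      then have "fin_E x \<le> fin_E (g a)" using E_fin_dom[OF x] E_fin_dom[OF g(1)[of a]] that by simp
      moreover have "0 < a * q" using False that by simp
      ultimately show False using q[OF that] by simp
    qed
    have "0 < d" using pos[of 1] g(2)[of 1] by simp
    have "ereal (q / d) \<le> E_slope x" unfolding E_slope_def
    proof (rule INF_greatest)
      fix r :: real assume "r \<in> {0<..}"
      then have r: "0 < r" by simp
      define a where "a = min 1 (r / (2 * d))"
      have a: "0 < a" "a \<le> 1" using r \<open>0 < d\<close> by (auto simp: a_def)
      have "a * d \<le> r / (2 * d) * d" using \<open>0 < d\<close> by (intro mult_right_mono) (auto simp: a_def)
      then have "a * d < r" using r \<open>0 < d\<close> by simp
      then have mem: "g a \<in> {y\<in>P. 0 < W x y \<and> W x y < r}"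
        using g(1,2)[of a] pos[of a] a fin_dom_subset by force
      have "q / d = (a * q) / (a * d)" using a by simp
      also have "\<dots> \<le> (a * q) / W x (g a)"
        using False a g(2)[of a] pos[of a] by (intro divide_left_mono) (auto simp: mult_pos_pos \<open>0 < d\<close>)
      also have "\<dots> \<le> (fin_E x - fin_E (g a)) / W x (g a)"
        using q[OF a] pos[OF a] by (intro divide_right_mono) auto
      also have "\<dots> \<le> max 0 (fin_E x - fin_E (g a)) / W x (g a)"
        using pos[OF a] by (intro divide_right_mono) auto
      finally have "ereal (q / d) \<le> max 0 (E x - E (g a)) / ereal (W x (g a))"
        using pos[OF a] a E_fin_dom[OF x] E_fin_dom[OF g(1)[of a]]
        by (simp add: ereal_max[symmetric] zero_ereal_def del: ereal_max)
      then show "ereal (q / d) \<le> (SUP y\<in>{y\<in>P. 0 < W x y \<and> W x y < r}.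
          max 0 (E x - E y) / ereal (W x y))"
        by (rule SUP_upper2[OF mem])
    qed
    then have "q / d \<le> \<bar>real_of_ereal (E_slope x)\<bar>"
      using fin by (cases "E_slope x") auto
    then have "q \<le> \<bar>real_of_ereal (E_slope x)\<bar> * d" using \<open>0 < d\<close> by (simp add: field_simps)
    then show ?thesis unfolding d_def[symmetric] q_def by linarith
  qed
qed

section \<open>Comparison of two step sizes\<close>

text \<open>The discrete variational inequality for \<open>(a, A)\<close> is weighted by \<open>h / t\<close> so that the energy of
  \<open>A\<close> cancels against the one for \<open>(b, B)\<close>; the surplus multiple of \<open>W A b\<^sup>2\<close> is absorbed using \<open>W a A\<^sup>2\<close>.\<close>

lemma one_step:
  assumes a: "a \<in> fin_dom" and b: "b \<in> fin_dom"
    and A: "is_minimizer t a A" and B: "is_minimizer h b B"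
    and h: "0 < h" "h \<le> t" "L * t < 1"
  shows "(1 - L * h)\<^sup>2 * (W A B)\<^sup>2 \<le> h / t * (1 / (1 - L * t)) * (W a b)\<^sup>2 + (t - h) / t * (W b A)\<^sup>2
    + (1 - L * h) * (2 * h * (fin_E b - fin_E B) - (W b B)\<^sup>2)"
proof -
  define th where "th = h / t"
  define x where "x = L * h"
  have t: "0 < t" using h by simp
  have th: "0 < th" "th \<le> 1" "h = th * t" using h by (auto simp: th_def)
  have "L * h \<le> L * t" using h L_nonneg by (intro mult_left_mono)
  then have Lh: "x < 1" using h by (simp add: x_def)
  have "(L * t) * th < 1 * th" using h th by (intro mult_strict_right_mono) auto
  then have xth: "x < th" by (simp add: x_def th(3) mult_ac)
  have A': "A \<in> fin_dom" and B': "B \<in> fin_dom" using minimizer_fin_dom A B a b by auto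
  have 1: "(1 - x) * (W B A)\<^sup>2 - (W b A)\<^sup>2 \<le> 2 * h * (fin_E A - fin_E B) - (W b B)\<^sup>2"
    using evi[OF B fin_dom_subset[OF b] B' A'] h Lh by (simp add: x_def)
  have "th * ((1 - L * t) * (W A b)\<^sup>2 - (W a b)\<^sup>2) \<le> th * (2 * t * (fin_E b - fin_E A) - (W a A)\<^sup>2)"
    using evi[OF A fin_dom_subset[OF a] A' b t h(3)] th by (intro mult_left_mono) auto
  then have 2: "(th - x) * (W A b)\<^sup>2 - th * (W a b)\<^sup>2 \<le> 2 * h * (fin_E b - fin_E A) - th * (W a A)\<^sup>2"
    by (simp add: x_def th(3) algebra_simps)
  define D where "D = W A b"
  have s: "W B A = W A B" "W b A = D" by (auto simp: W_sym D_def)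
  have "(1 - x) * (W A B)\<^sup>2 \<le> th * (W a b)\<^sup>2 + (1 - th + x) * D\<^sup>2 - th * (W a A)\<^sup>2
    + (2 * h * (fin_E b - fin_E B) - (W b B)\<^sup>2)" (is "?l \<le> ?r")
    using 1 2 unfolding s D_def[symmetric] by (simp add: algebra_simps)
  \<comment> \<open>The extra factor works because
    \<open>(1 - x) * (1 - th + x) = (1 - th) + x * (th - x)\<close>: the first summand is the wanted
    coefficient \<open>(t - h) / t\<close>, the second is the surplus.\<close>
  then have "(1 - x) * ?l \<le> (1 - x) * ?r" using Lh by (intro mult_left_mono) auto
  then have "(1 - x)\<^sup>2 * (W A B)\<^sup>2 \<le> (1 - x) * ?r" by (simp add: power2_eq_square mult_ac)
  moreover have "(1 - x) * ?r = (1 - x) * th * (W a b)\<^sup>2 + (1 - th) * D\<^sup>2 + x * (th - x) * D\<^sup>2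
      - (1 - x) * th * (W a A)\<^sup>2 + (1 - x) * (2 * h * (fin_E b - fin_E B) - (W b B)\<^sup>2)"
    by (simp add: algebra_simps power2_eq_square)
  moreover have "x * (th - x) * D\<^sup>2 + (1 - x) * th * (W a b)\<^sup>2 \<le>
      th\<^sup>2 / (th - x) * (W a b)\<^sup>2 + (1 - x) * th * (W a A)\<^sup>2"
  proof -
    have "x * (th - x) * D\<^sup>2 \<le> (th\<^sup>2 / (th - x) - (1 - x) * th) * (W a b)\<^sup>2 + (1 - x) * th * (W a A)\<^sup>2"
    proof (rule absorb_surplus)
      show "0 \<le> x" using L_nonneg h by (simp add: x_def)
      show "D \<le> W a b + W a A" using W_triangle[of A a b] fin_dom_subset[OF A'] fin_dom_subset[OF a]
          fin_dom_subset[OF b] by (simp add: D_def W_sym[of A a])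
    qed (use Lh th xth W_nonneg D_def in auto)
    then show ?thesis by (simp add: left_diff_distrib)
  qed
  moreover have c: "th\<^sup>2 / (th - x) = h / t * (1 / (1 - L * t))"
  proof -
    have "th - x = th * (1 - L * t)" by (simp add: x_def th(3) algebra_simps)
    then show ?thesis using th t by (simp add: power2_eq_square th_def[symmetric])
  qed
  moreover have k: "(t - h) / t = 1 - th" using t by (simp add: th_def field_simps)
  ultimately show ?thesis unfolding x_def[symmetric] s c[symmetric] k by linarith
qed

section \<open>Increments and energy drops along the iterates\<close>

lemma iterates:
  assumes "\<And>w. w \<in> fin_dom \<Longrightarrow> is_minimizer t w (J w)" "x \<in> fin_dom"
  shows "(J ^^ k) x \<in> fin_dom"
  by (induction k) (use assms minimizer_fin_dom in auto)

text \<open>In the base case the first step is tested with its own starting point and the slope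
  bounds the drop. In the induction two inequalities are added, the step from \<open>u\<close>
  tested with \<open>w\<close> and the step from \<open>v\<close> tested with \<open>v\<close>; the
  energies cancel and the triangle inequality leaves \<open>(1 - L * h) * q \<le> p\<close>.\<close>

lemma increment_bound:
  assumes J: "\<And>w. w \<in> fin_dom \<Longrightarrow> is_minimizer h w (J w)" and x: "x \<in> fin_dom"
    and s: "E_slope x < \<infinity>" and h: "0 < h" "L * h < 1"
  shows "(1 - L * h) ^ Suc k * W ((J ^^ k) x) ((J ^^ Suc k) x) \<le> h * \<bar>real_of_ereal (E_slope x)\<bar>"
proof (induction k)
  case 0
  define q where "q = W x (J x)"
  have Jx: "J x \<in> fin_dom" using minimizer_fin_dom[OF J[OF x] x] .
  have "(1 - L * h) * q\<^sup>2 \<le> 2 * h * (fin_E x - fin_E (J x)) - q\<^sup>2"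
    using evi[OF J[OF x] fin_dom_subset[OF x] Jx x h] W_refl[OF fin_dom_subset[OF x]]
    by (simp add: q_def W_sym)
  also have "\<dots> \<le> 2 * h * (\<bar>real_of_ereal (E_slope x)\<bar> * q + (L / 2) * q\<^sup>2) - q\<^sup>2"
    using slope_estimate[OF x Jx s] h unfolding q_def by (intro diff_right_mono mult_left_mono) auto
  finally have *: "q * ((1 - L * h) * q) \<le> q * (h * \<bar>real_of_ereal (E_slope x)\<bar>)"
    by (simp add: algebra_simps power2_eq_square)
  show ?case
  proof (cases "q = 0")
    case False
    then have "0 < q" using W_nonneg by (simp add: q_def less_le)
    with * show ?thesis by (simp add: q_def)
  next
    case True
    then show ?thesis
      using mult_nonneg_nonneg[OF less_imp_le[OF h(1)] abs_ge_zero] by (simp add: q_def)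
  qed
next
  case (Suc k)
  define u v w where "u = (J ^^ k) x" and "v = J u" and "w = J v"
  have dom: "u \<in> fin_dom" "v \<in> fin_dom" "w \<in> fin_dom"
    using iterates[OF J x, of k] iterates[OF J x, of "Suc k"] iterates[OF J x, of "Suc (Suc k)"]
    by (simp_all add: u_def v_def w_def)
  have dP: "u \<in> P" "v \<in> P" "w \<in> P" using dom fin_dom_subset by auto
  define p q where "p = W u v" and "q = W v w"
  have pq: "0 \<le> p" "0 \<le> q" by (auto simp: p_def q_def W_nonneg)
  have 1: "(1 - L * h) * q\<^sup>2 - (W u w)\<^sup>2 \<le> 2 * h * (fin_E w - fin_E v) - p\<^sup>2"
    using evi[of h u v w] J[of u] dom dP h by (simp add: v_def[symmetric] p_def q_def)
  have 2: "(1 - L * h) * q\<^sup>2 \<le> 2 * h * (fin_E v - fin_E w) - q\<^sup>2"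
    using evi[of h v w v] J[of v] dom dP h W_refl[of v] by (simp add: w_def[symmetric] W_sym[of w v] q_def)
  have "(W u w)\<^sup>2 \<le> (p + q)\<^sup>2"
    using W_triangle[of u v w] dP W_nonneg by (intro power_mono) (auto simp: p_def q_def)
  with 1 2 have *: "q * ((1 - L * h) * q) \<le> q * p" by (simp add: algebra_simps power2_eq_square)
  have "(1 - L * h) * q \<le> p"
  proof (cases "q = 0")
    case False with * pq show ?thesis by simp
  qed (use pq in simp)
  then have "(1 - L * h) ^ Suc k * ((1 - L * h) * q) \<le> (1 - L * h) ^ Suc k * p"
    using h by (intro mult_left_mono) auto
  also have "\<dots> \<le> h * \<bar>real_of_ereal (E_slope x)\<bar>"
    using Suc by (simp add: u_def v_def p_def)
  finally show ?case by (simp add: u_def v_def w_def q_def mult_ac)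
qed

text \<open>\<open>p\<close> bounds the previous increment and \<open>q\<close> is the current one.
  Testing the previous step with \<open>B\<close>, or using the slope when there is no previous
  step, bounds the drop by terms in \<open>p\<close> and \<open>q\<close>; completing the square
  then eliminates \<open>q\<close>.\<close>

lemma energy_drop_bound:
  fixes k :: nat
  assumes J: "\<And>w. w \<in> fin_dom \<Longrightarrow> is_minimizer h w (J w)" and x: "x \<in> fin_dom"
    and s: "E_slope x < \<infinity>" and h: "0 < h" "L * h < 1"
  defines "b \<equiv> (J ^^ k) x" and "B \<equiv> (J ^^ Suc k) x"
  shows "(1 - L * h) * (2 * h * (fin_E b - fin_E B) - (W b B)\<^sup>2)
    \<le> h\<^sup>2 * (1 / (1 - L * h) ^ (2 * k)) * (real_of_ereal (E_slope x))\<^sup>2"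
proof -
  have dom: "b \<in> fin_dom" "B \<in> fin_dom" unfolding b_def B_def using iterates[OF J x] by blast+
  define y where "y = 1 - L * h"
  have y: "0 < y" using h by (simp add: y_def)
  define p where "p = h * \<bar>real_of_ereal (E_slope x)\<bar> / y ^ k"
  define q where "q = W b B"
  have "0 \<le> q" by (simp add: q_def W_nonneg)
  have "2 * h * (fin_E b - fin_E B) \<le> 2 * p * q + L * h * q\<^sup>2"
  proof (cases k)
    case 0
    have "2 * h * (fin_E b - fin_E B) \<le> 2 * h * (\<bar>real_of_ereal (E_slope x)\<bar> * q + (L / 2) * q\<^sup>2)"
      using slope_estimate[of x B] dom s x h 0 unfolding q_def by (intro mult_left_mono) (auto simp: b_def)
    then show ?thesis using 0 by (simp add: p_def algebra_simps)
  next
    case (Suc j)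
    define u where "u = (J ^^ j) x"
    have u: "u \<in> fin_dom" "b = J u" using iterates[OF J x] by (auto simp: u_def b_def Suc)
    define r where "r = W u b"
    have "y ^ k * r \<le> h * \<bar>real_of_ereal (E_slope x)\<bar>"
      using increment_bound[OF J x s h, of j] by (simp add: y_def r_def u_def b_def Suc)
    then have r: "r \<le> p" using y by (simp add: p_def field_simps)
    have "(1 - L * h) * q\<^sup>2 - (W u B)\<^sup>2 \<le> 2 * h * (fin_E B - fin_E b) - r\<^sup>2"
      using evi[of h u b B] J[of u] u dom h fin_dom_subset by (auto simp: r_def q_def)
    moreover have "(W u B)\<^sup>2 \<le> (r + q)\<^sup>2"
      using W_triangle[of u b B] u dom fin_dom_subset W_nonneg
      by (intro power_mono) (auto simp: r_def q_def)
    moreover have "r * q \<le> p * q" using r \<open>0 \<le> q\<close> by (intro mult_right_mono)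
    ultimately show ?thesis by (simp add: algebra_simps power2_eq_square)
  qed
  then have "2 * h * (fin_E b - fin_E B) - q\<^sup>2 \<le> 2 * p * q - y * q\<^sup>2" (is "?l \<le> _")
    by (simp add: y_def algebra_simps)
  then have "y * ?l \<le> y * (2 * p * q - y * q\<^sup>2)" using y by (intro mult_left_mono) auto
  also have "\<dots> = p\<^sup>2 - (p - y * q)\<^sup>2" by (simp add: algebra_simps power2_eq_square)
  also have "\<dots> \<le> p\<^sup>2" by simp
  finally show ?thesis
    by (simp add: p_def y_def q_def power_divide power_mult_distrib power_mult[symmetric] mult.commute)
qed

section \<open>Existence of minimizers\<close>

text \<open>Coercivity at the single step size \<open>t0\<close> serves only to bound
  \<open>E\<close> below near \<open>w\<close>. Convexity along curves from \<open>w\<close> carries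
  the bound outward with quadratic loss \<open>L / 2\<close>, which any step with
  \<open>L * t < 1\<close> can compensate.\<close>

lemma E_quadratic_lower_bound:
  assumes w: "w \<in> fin_dom" and u: "u \<in> P" and t0: "0 < t0"
    and coer: "\<And>v. v \<in> P \<Longrightarrow> ereal C \<le> ereal ((W u v)\<^sup>2 / (2 * t0)) + E v"
  obtains K where "0 \<le> K"
    and "\<And>v. v \<in> fin_dom \<Longrightarrow> - K * (1 + W w v) - (L / 2) * (W w v)\<^sup>2 \<le> fin_E v"
proof
  define K where "K = \<bar>C\<bar> + \<bar>fin_E w\<bar> + (W u w + 1)\<^sup>2 / (2 * t0)"
  have "0 \<le> (W u w + 1)\<^sup>2 / (2 * t0)" using t0 by simp
  then show K0: "0 \<le> K" unfolding K_def by linarith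
  fix v assume v: "v \<in> fin_dom"
  define d where "d = W w v"
  have d0: "0 \<le> d" by (simp add: d_def W_nonneg)
  obtain g where g: "\<And>a. 0 \<le> a \<Longrightarrow> a \<le> 1 \<Longrightarrow> g a \<in> fin_dom"
    "\<And>a. 0 \<le> a \<Longrightarrow> a \<le> 1 \<Longrightarrow> W w (g a) \<le> a * d"
    "\<And>a. 0 \<le> a \<Longrightarrow> a \<le> 1 \<Longrightarrow>
      fin_E (g a) \<le> (1 - a) * fin_E w + a * fin_E v + a * (1 - a) * (L / 2) * d\<^sup>2"
    using convex_from_base[OF w v] unfolding d_def by metis
  \<comment> \<open>This puts \<open>g a\<close> within distance 1 of \<open>w\<close>, and
    \<open>K / a\<close> grows only linearly in \<open>d\<close>.\<close>
  define a where "a = 1 / max 1 d"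
  have a: "0 < a" "a \<le> 1" "a * d \<le> 1" using d0 by (auto simp: a_def)
  have ga: "g a \<in> fin_dom" using g(1) a by simp
  have "C \<le> (W u (g a))\<^sup>2 / (2 * t0) + fin_E (g a)"
    using coer[OF fin_dom_subset[OF ga]] E_fin_dom[OF ga] by simp
  moreover have "(W u (g a))\<^sup>2 / (2 * t0) \<le> (W u w + 1)\<^sup>2 / (2 * t0)"
  proof (intro divide_right_mono power_mono)
    show "W u (g a) \<le> W u w + 1"
      using W_triangle[OF u fin_dom_subset[OF w] fin_dom_subset[OF ga]] g(2)[of a] a by simp
  qed (use t0 W_nonneg in auto)
  moreover have "(1 - a) * fin_E w \<le> \<bar>fin_E w\<bar>"
    using a abs_ge_self[of "fin_E w"] mult_left_mono[of "fin_E w" "\<bar>fin_E w\<bar>" "1 - a"] mult_right_mono[of "1 - a" 1 "\<bar>fin_E w\<bar>"]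
    by simp
  ultimately have "- K \<le> a * fin_E v + a * (1 - a) * (L / 2) * d\<^sup>2"
    using g(3)[of a] a abs_ge_minus_self[of C] unfolding K_def by linarith
  also have "\<dots> \<le> a * fin_E v + a * (L / 2) * d\<^sup>2"
    using a L_nonneg by (intro add_left_mono mult_right_mono) auto
  finally have "- K / a \<le> fin_E v + (L / 2) * d\<^sup>2"
    using a by (simp add: field_simps)
  moreover have "K * max 1 d \<le> K * (1 + d)" using K0 d0 by (intro mult_left_mono) auto
  ultimately show "- K * (1 + W w v) - (L / 2) * (W w v)\<^sup>2 \<le> fin_E v"
    unfolding d_def[symmetric] by (simp add: a_def)
qed

text \<open>The direct method with convexity in place of compactness: \<Phi> has convexity modulus
  \<kappa> along curves with base \<open>w\<close>, so comparing with midpoints bounds the distance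
  of two almost minimizers by their excess.\<close>

lemma minimizer_exists:
  assumes w: "w \<in> fin_dom" and t: "0 < t" "L * t < 1" and u: "u \<in> P" and t0: "0 < t0"
    and coer: "\<And>v. v \<in> P \<Longrightarrow> ereal C \<le> ereal ((W u v)\<^sup>2 / (2 * t0)) + E v"
  shows "\<exists>x. is_minimizer t w x"
proof -
  define \<kappa> where "\<kappa> = 1 / t - L"
  have \<kappa>: "0 < \<kappa>" using t by (simp add: \<kappa>_def field_simps)
  define \<Phi> where "\<Phi> v = (W w v)\<^sup>2 / (2 * t) + fin_E v" for v
  obtain K where K: "0 \<le> K"
    "\<And>v. v \<in> fin_dom \<Longrightarrow> - K * (1 + W w v) - (L / 2) * (W w v)\<^sup>2 \<le> fin_E v"
    using E_quadratic_lower_bound[OF w u t0 coer] by metis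
  have "- K - K\<^sup>2 / (2 * \<kappa>) \<le> \<Phi> v" if "v \<in> fin_dom" for v
  proof -
    define d where "d = W w v"
    \<comment> \<open>Young's inequality: the linear loss \<open>K * d\<close> cannot outweigh the
      quadratic term.\<close>
    have "0 \<le> (\<kappa> * d - K)\<^sup>2 / (2 * \<kappa>)" using \<kappa> by simp
    also have "\<dots> = \<kappa> / 2 * d\<^sup>2 - K * d + K\<^sup>2 / (2 * \<kappa>)"
      using \<kappa> by (simp add: field_simps power2_eq_square)
    finally have "- K - K\<^sup>2 / (2 * \<kappa>) \<le> \<kappa> / 2 * d\<^sup>2 - K * (1 + d)" by (simp add: algebra_simps)
    also have "\<dots> \<le> \<Phi> v" using K(2)[OF that]
      by (simp add: \<Phi>_def d_def[symmetric] \<kappa>_def algebra_simps)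
    finally show ?thesis .
  qed
  then have bdd: "bdd_below (\<Phi> ` fin_dom)" by (intro bdd_belowI) auto
  define I where "I = Inf (\<Phi> ` fin_dom)"
  have I: "I \<le> \<Phi> v" if "v \<in> fin_dom" for v
    unfolding I_def by (intro cInf_lower bdd) (use that in auto)
  \<comment> \<open>The excess is fitted to the midpoint comparison: the factor
    \<open>\<kappa> / 8\<close> cancels, and consecutive distances meet the hypothesis of
    \<open>W_complete\<close>.\<close>
  have "\<exists>v\<in>fin_dom. \<Phi> v \<le> I + \<kappa> / 8 * (1/8) ^ n" for n
  proof -
    have "Inf (\<Phi> ` fin_dom) < I + \<kappa> / 8 * (1/8) ^ n" using \<kappa> by (simp add: I_def)
    then have "\<exists>r\<in>\<Phi> ` fin_dom. r < I + \<kappa> / 8 * (1/8) ^ n" using w by (intro cInf_lessD) auto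
    then show ?thesis by (auto intro: less_imp_le)
  qed
  then obtain s where s: "\<And>n. s n \<in> fin_dom" "\<And>n. \<Phi> (s n) \<le> I + \<kappa> / 8 * (1/8) ^ n"
    by metis
  have sP: "s n \<in> P" for n using s(1) by (rule fin_dom_subset)
  have midpoint: "\<kappa> / 8 * (W x y)\<^sup>2 \<le> (\<Phi> x - I) / 2 + (\<Phi> y - I) / 2"
    if xy: "x \<in> fin_dom" "y \<in> fin_dom" for x y
  proof -
    obtain g D where D: "(W x y)\<^sup>2 \<le> D"
      and g: "\<And>a. 0 \<le> a \<Longrightarrow> a \<le> 1 \<Longrightarrow> g a \<in> fin_dom"
      "\<And>a. 0 \<le> a \<Longrightarrow> a \<le> 1 \<Longrightarrow>
      (W w (g a))\<^sup>2 \<le> (1 - a) * (W w x)\<^sup>2 + a * (W w y)\<^sup>2 - a * (1 - a) * D"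
      "\<And>a. 0 \<le> a \<Longrightarrow> a \<le> 1 \<Longrightarrow>
      fin_E (g a) \<le> (1 - a) * fin_E x + a * fin_E y + a * (1 - a) * (L / 2) * D"
      using convex_fin_dom[OF fin_dom_subset[OF w] xy] by metis
    have "I \<le> \<Phi> (g (1/2))" using I g(1)[of "1/2"] by simp
    also have "\<dots> \<le> ((W w x)\<^sup>2 / 2 + (W w y)\<^sup>2 / 2 - D / 4) / (2 * t)
        + (fin_E x / 2 + fin_E y / 2 + L * D / 8)"
      unfolding \<Phi>_def using g(2,3)[of "1/2"] t by (intro add_mono divide_right_mono) auto
    also have "\<dots> = \<Phi> x / 2 + \<Phi> y / 2 - \<kappa> / 8 * D"
      using t by (simp add: \<Phi>_def \<kappa>_def field_simps)
    finally have "\<kappa> / 8 * D \<le> (\<Phi> x - I) / 2 + (\<Phi> y - I) / 2" by (simp add: field_simps)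
    moreover have "\<kappa> / 8 * (W x y)\<^sup>2 \<le> \<kappa> / 8 * D" using D \<kappa> by (intro mult_left_mono) auto
    ultimately show ?thesis by simp
  qed
  have "(W (s n) (s (Suc n)))\<^sup>2 \<le> (1/8) ^ n" for n
  proof -
    have "\<kappa> / 8 * (1/8) ^ Suc n \<le> \<kappa> / 8 * (1/8) ^ n"
      using \<kappa> by (intro mult_left_mono power_decreasing) auto
    then have "\<Phi> (s (Suc n)) \<le> I + \<kappa> / 8 * (1/8) ^ n"
      by (intro order_trans[OF s(2)] add_left_mono)
    then have "(\<Phi> (s n) - I) / 2 + (\<Phi> (s (Suc n)) - I) / 2 \<le> \<kappa> / 8 * (1/8) ^ n"
      using s(2)[of n] by argo
    with midpoint[OF s(1) s(1), of n "Suc n"]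
    have "\<kappa> / 8 * (W (s n) (s (Suc n)))\<^sup>2 \<le> \<kappa> / 8 * (1/8) ^ n"
      by (rule order_trans)
    then show ?thesis using \<kappa> by simp
  qed
  then obtain l where l: "l \<in> P" "(\<lambda>n. W (s n) l) \<longlonglongrightarrow> 0"
    using W_complete[of s, OF sP] by blast
  have wP: "w \<in> P" using w fin_dom_subset by auto
  have Wlim: "(\<lambda>n. W w (s n)) \<longlonglongrightarrow> W w l"
  proof (rule LIM_zero_cancel, rule tendsto_0_le[OF l(2), of _ 1])
    show "\<forall>\<^sub>F n in sequentially. norm (W w (s n) - W w l) \<le> norm (W (s n) l) * 1"
    proof (intro always_eventually allI)
      fix n show "norm (W w (s n) - W w l) \<le> norm (W (s n) l) * 1"
        using W_triangle[OF wP sP l(1), of n] W_triangle[OF wP l(1) sP, of n] W_nonneg[of "s n" l]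
        by (simp add: W_sym[of l] abs_le_iff)
    qed
  qed
  have "(\<lambda>n. \<kappa> / 8 * (1/8) ^ n) \<longlonglongrightarrow> 0"
    by (intro tendsto_mult_right_zero LIMSEQ_realpow_zero) auto
  from tendsto_add[OF tendsto_const[of I] this]
  have "(\<lambda>n. I + \<kappa> / 8 * (1/8) ^ n) \<longlonglongrightarrow> I" by simp
  then have "(\<lambda>n. \<Phi> (s n)) \<longlonglongrightarrow> I"
    by (rule tendsto_sandwich[OF _ _ tendsto_const, rotated 2]) (intro always_eventually allI I s)+
  \<comment> \<open>The distance term is continuous, so subtracting it leaves convergence of the
    energies, to which lower semicontinuity applies.\<close>
  then have "(\<lambda>n. \<Phi> (s n) - (W w (s n))\<^sup>2 / (2 * t)) \<longlonglongrightarrow> I - (W w l)\<^sup>2 / (2 * t)"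
    using t by (intro tendsto_diff tendsto_divide tendsto_power tendsto_const Wlim) auto
  then have "(\<lambda>n. E (s n)) \<longlonglongrightarrow> ereal (I - (W w l)\<^sup>2 / (2 * t))"
    by (simp add: \<Phi>_def E_fin_dom[OF s(1)])
  then have "liminf (\<lambda>n. E (s n)) = ereal (I - (W w l)\<^sup>2 / (2 * t))"
    by (rule lim_imp_Liminf[rotated]) simp
  then have El: "E l \<le> ereal (I - (W w l)\<^sup>2 / (2 * t))" using E_lsc[OF l(1) sP l(2)] by simp
  have "is_minimizer t w l" unfolding is_minimizer_def
  proof (intro conjI ballI l(1))
    fix y assume y: "y \<in> P"
    have "ereal ((W w l)\<^sup>2 / (2 * t)) + E l \<le> ereal I"
      using El by (cases "E l") auto
    also have "\<dots> \<le> ereal ((W w y)\<^sup>2 / (2 * t)) + E y"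
    proof (cases "y \<in> fin_dom")
      case True then show ?thesis using I[OF True] E_fin_dom[OF True] by (simp add: \<Phi>_def)
    next
      case False then show ?thesis using y by (auto simp: fin_dom_def)
    qed
    finally show "ereal ((W w l)\<^sup>2 / (2 * t)) + E l \<le> ereal ((W w y)\<^sup>2 / (2 * t)) + E y" .
  qed
  then show ?thesis ..
qed

end

section \<open>The Wasserstein space as an instance\<close>

lemma W2_nonneg: "0 \<le> W2 \<mu> \<nu>"
  by (simp add: W2_def)

lemma W2_sym: "W2 \<mu> \<nu> = W2 \<nu> \<mu>"
  by (simp add: W2_def W2sq_sym[of \<mu>])

lemma W2sq_finite_P2:
  assumes "\<mu> \<in> P2 \<omega>0" "\<nu> \<in> P2 \<omega>0"
  shows "W2sq \<mu> \<nu> < \<infinity>"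
  using assms W2sq_finite_trans[of \<mu> \<omega>0 \<nu>] by (simp add: P2_def W2sq_sym[of \<omega>0])

text \<open>Finiteness matters because \<open>enn2real\<close> sends an infinite cost to 0.\<close>

lemma W2sq_eq_P2:
  assumes "\<mu> \<in> P2 \<omega>0" "\<nu> \<in> P2 \<omega>0"
  shows "W2sq \<mu> \<nu> = ennreal ((W2 \<mu> \<nu>)\<^sup>2)"
  using W2sq_finite_P2[OF assms] by (simp add: W2_def)

lemma W2_square_le:
  assumes "W2sq \<mu> \<nu> \<le> ennreal c" "0 \<le> c"
  shows "(W2 \<mu> \<nu>)\<^sup>2 \<le> c"
  using enn2real_mono[OF assms(1)] assms(2) by (simp add: W2_def)

text \<open>For positive \<open>X\<close> and \<open>Y\<close> the bound is smallest at
  \<open>t = Y / X\<close>, where it equals \<open>(X + Y)\<^sup>2\<close>.\<close>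

lemma weighted_square_sum_le:
  fixes c X Y :: real
  assumes c: "\<And>t. 0 < t \<Longrightarrow> c \<le> (1 + t) * X\<^sup>2 + (1 + 1 / t) * Y\<^sup>2" and "0 \<le> c" "0 \<le> X" "0 \<le> Y"
  shows "sqrt c \<le> X + Y"
proof (rule field_le_epsilon)
  fix e :: real assume "0 < e"
  \<comment> \<open>The shift by \<open>e / 2\<close> makes both numbers positive, so that this
    choice of \<open>t\<close> is available.\<close>
  define X' Y' where "X' = X + e / 2" and "Y' = Y + e / 2"
  have X': "0 < X'" "X \<le> X'" and Y': "0 < Y'" "Y \<le> Y'" using assms \<open>0 < e\<close> by (auto simp: X'_def Y'_def)
  have t: "0 < Y' / X'" using X' Y' by simp
  have "c \<le> (1 + Y' / X') * X\<^sup>2 + (1 + 1 / (Y' / X')) * Y\<^sup>2" by (rule c[OF t])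
  also have "\<dots> \<le> (1 + Y' / X') * X'\<^sup>2 + (1 + 1 / (Y' / X')) * Y'\<^sup>2"
    using X' Y' assms by (intro add_mono mult_left_mono power_mono) auto
  also have "\<dots> = (X' + Y')\<^sup>2" using X' Y' by (simp add: power2_eq_square field_simps)
  finally have "sqrt c \<le> X' + Y'" using X' Y' by (intro real_le_lsqrt) auto
  then show "sqrt c \<le> X + Y + e" by (simp add: X'_def Y'_def)
qed

section \<open>Transport plans and generalized geodesics\<close>

lemma transport_planD:
  assumes "\<Omega> \<in> transport_plans \<omega> \<mu>0 \<mu>1"
  shows "prob_space \<Omega>" "sets \<Omega> = sets borel"
    and "fst \<in> \<Omega> \<rightarrow>\<^sub>M borel" "(\<lambda>x. fst (snd x)) \<in> \<Omega> \<rightarrow>\<^sub>M borel" "(\<lambda>x. snd (snd x)) \<in> \<Omega> \<rightarrow>\<^sub>M borel"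
    and "distr \<Omega> borel fst = \<omega>" "distr \<Omega> borel (\<lambda>x. fst (snd x)) = \<mu>0" "distr \<Omega> borel (\<lambda>x. snd (snd x)) = \<mu>1"
    and "(\<integral>\<^sup>+ x. ennreal ((norm (fst x - fst (snd x)))\<^sup>2) \<partial>\<Omega>) = W2sq \<omega> \<mu>0"
    and "(\<integral>\<^sup>+ x. ennreal ((norm (fst x - snd (snd x)))\<^sup>2) \<partial>\<Omega>) = W2sq \<omega> \<mu>1"
proof -
  show \<Omega>: "prob_space \<Omega>" and s: "sets \<Omega> = sets borel"
    using assms by (auto simp: transport_plans_def)
  show m1: "fst \<in> \<Omega> \<rightarrow>\<^sub>M borel" and m2: "(\<lambda>x. fst (snd x)) \<in> \<Omega> \<rightarrow>\<^sub>M borel"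
    and m3: "(\<lambda>x. snd (snd x)) \<in> \<Omega> \<rightarrow>\<^sub>M borel"
    unfolding measurable_cong_sets[OF s refl] borel_prod[symmetric] by measurable
  have c12: "distr \<Omega> borel (\<lambda>x. (fst x, fst (snd x))) \<in> opt_couplings \<omega> \<mu>0"
    and c13: "distr \<Omega> borel (\<lambda>x. (fst x, snd (snd x))) \<in> opt_couplings \<omega> \<mu>1"
    using assms by (auto simp: transport_plans_def pi12_def[abs_def] pi13_def[abs_def])
  note 12 = coupling_of_maps[OF \<Omega> m1 m2] and 13 = coupling_of_maps[OF \<Omega> m1 m3]
  show "distr \<Omega> borel fst = \<omega>" "distr \<Omega> borel (\<lambda>x. fst (snd x)) = \<mu>0" "distr \<Omega> borel (\<lambda>x. snd (snd x)) = \<mu>1"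
    using 12(1) 13(1) c12 c13 by (auto simp: opt_couplings_def couplings_def)
  show "(\<integral>\<^sup>+ x. ennreal ((norm (fst x - fst (snd x)))\<^sup>2) \<partial>\<Omega>) = W2sq \<omega> \<mu>0"
    "(\<integral>\<^sup>+ x. ennreal ((norm (fst x - snd (snd x)))\<^sup>2) \<partial>\<Omega>) = W2sq \<omega> \<mu>1"
    using 12(2) 13(2) c12 c13 by (auto simp: opt_couplings_def)
qed

text \<open>The last two coordinates of a plan couple \<mu>0 with \<mu>1, in general not
  optimally.\<close>

lemma W2sq_le_W2plan_sq:
  assumes "\<Omega> \<in> transport_plans \<omega> \<mu>0 \<mu>1"
  shows "W2sq \<mu>0 \<mu>1 \<le> W2plan_sq \<Omega>"
  using W2sq_le_maps[OF transport_planD(1,4,5)[OF assms]]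
  unfolding transport_planD(7,8)[OF assms] W2plan_sq_def .

lemma norm_diff_square_le_weighted:
  fixes x y z :: "'a::real_normed_vector" and t :: real
  assumes "0 < t"
  shows "(norm (y - z))\<^sup>2 \<le> (1 + t) * (norm (x - y))\<^sup>2 + (1 + 1 / t) * (norm (x - z))\<^sup>2"
proof -
  define p q where "p = norm (x - y)" and "q = norm (x - z)"
  have "norm (y - z) \<le> p + q"
    using norm_triangle_ineq[of "y - x" "x - z"] by (simp add: p_def q_def norm_minus_commute)
  then have "(norm (y - z))\<^sup>2 \<le> (p + q)\<^sup>2" by (intro power_mono) auto
  also have "\<dots> \<le> (p + q)\<^sup>2 + (t * p - q)\<^sup>2 / t" using assms by simp
  also have "\<dots> = (1 + t) * p\<^sup>2 + (1 + 1 / t) * q\<^sup>2"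
    using assms by (simp add: power2_eq_square field_simps)
  finally show ?thesis by (simp add: p_def q_def)
qed

text \<open>Serves twice: \<open>t = 1\<close> gives finiteness of the plan cost, and free
  \<open>t\<close> gives the sharp triangle inequality.\<close>

lemma W2plan_sq_le:
  assumes \<Omega>: "\<Omega> \<in> transport_plans \<omega> \<mu>0 \<mu>1" and t: "0 < t"
    and P: "\<omega> \<in> P2 \<omega>0" "\<mu>0 \<in> P2 \<omega>0" "\<mu>1 \<in> P2 \<omega>0"
  shows "W2plan_sq \<Omega> \<le> ennreal ((1 + t) * (W2 \<omega> \<mu>0)\<^sup>2 + (1 + 1 / t) * (W2 \<omega> \<mu>1)\<^sup>2)"
proof -
  note [measurable] = transport_planD(3-5)[OF \<Omega>]
  have "W2plan_sq \<Omega> \<le> (\<integral>\<^sup>+ x. ennreal (1 + t) * ennreal ((norm (fst x - fst (snd x)))\<^sup>2)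
      + ennreal (1 + 1 / t) * ennreal ((norm (fst x - snd (snd x)))\<^sup>2) \<partial>\<Omega>)"
    unfolding W2plan_sq_def
  proof (intro nn_integral_mono)
    fix x :: "'a \<times> 'a \<times> 'a"
    have "ennreal ((norm (fst (snd x) - snd (snd x)))\<^sup>2)
      \<le> ennreal ((1 + t) * (norm (fst x - fst (snd x)))\<^sup>2 + (1 + 1 / t) * (norm (fst x - snd (snd x)))\<^sup>2)"
      by (intro ennreal_leI norm_diff_square_le_weighted t)
    then show "ennreal ((norm (fst (snd x) - snd (snd x)))\<^sup>2)
      \<le> ennreal (1 + t) * ennreal ((norm (fst x - fst (snd x)))\<^sup>2)
        + ennreal (1 + 1 / t) * ennreal ((norm (fst x - snd (snd x)))\<^sup>2)"
      using t by (simp add: ennreal_mult[symmetric] ennreal_plus[symmetric] del: ennreal_plus)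
  qed
  also have "\<dots> = ennreal (1 + t) * W2sq \<omega> \<mu>0 + ennreal (1 + 1 / t) * W2sq \<omega> \<mu>1"
    by (simp add: nn_integral_add nn_integral_cmult transport_planD(9,10)[OF \<Omega>])
  also have "\<dots> = ennreal ((1 + t) * (W2 \<omega> \<mu>0)\<^sup>2 + (1 + 1 / t) * (W2 \<omega> \<mu>1)\<^sup>2)"
    using t by (simp add: W2sq_eq_P2[OF P(1,2)] W2sq_eq_P2[OF P(1,3)] ennreal_mult[symmetric]
        ennreal_plus[symmetric] del: ennreal_plus)
  finally show ?thesis .
qed

text \<open>The middle point is the base of the plan, which already glues the two optimal couplings;
  optimising over \<open>t\<close> plays the part of Minkowski's inequality.\<close>

lemma W2_triangle_plan:
  assumes "\<Omega> \<in> transport_plans \<omega> \<mu>0 \<mu>1" and "\<omega> \<in> P2 \<omega>0" "\<mu>0 \<in> P2 \<omega>0" "\<mu>1 \<in> P2 \<omega>0"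
  shows "W2 \<mu>0 \<mu>1 \<le> W2 \<omega> \<mu>0 + W2 \<omega> \<mu>1"
proof -
  have "sqrt ((W2 \<mu>0 \<mu>1)\<^sup>2) \<le> W2 \<omega> \<mu>0 + W2 \<omega> \<mu>1"
  proof (rule weighted_square_sum_le)
    fix t :: real assume t: "0 < t"
    show "(W2 \<mu>0 \<mu>1)\<^sup>2 \<le> (1 + t) * (W2 \<omega> \<mu>0)\<^sup>2 + (1 + 1 / t) * (W2 \<omega> \<mu>1)\<^sup>2"
      by (rule W2_square_le[OF order_trans[OF W2sq_le_W2plan_sq[OF assms(1)] W2plan_sq_le[OF assms(1) t assms(2-4)]]])
        (use t in simp)
  qed (auto simp: W2_nonneg)
  then show ?thesis by (simp add: W2_nonneg)
qed

lemma norm_diff_convex_combination: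
  fixes x y z :: "'a::real_inner"
  shows "(norm (x - ((1 - a) *\<^sub>R y + a *\<^sub>R z)))\<^sup>2 + a * (1 - a) * (norm (y - z))\<^sup>2
    = (1 - a) * (norm (x - y))\<^sup>2 + a * (norm (x - z))\<^sup>2"
  by (simp add: power2_norm_eq_inner inner_diff_left inner_diff_right inner_add_left inner_add_right
      inner_commute algebra_simps)

text \<open>The Hilbert space identity is integrated against the plan. Its couplings with the base
  are optimal, so the right-hand side is exact, while the base and the curve are merely coupled. The
  sum form avoids subtraction in \<open>ennreal\<close>.\<close>

lemma W2sq_gen_geod:
  assumes \<Omega>: "\<Omega> \<in> transport_plans \<omega> \<mu>0 \<mu>1" and a: "0 \<le> a" "a \<le> 1"
  shows "W2sq \<omega> (gen_geod \<Omega> a) + ennreal (a * (1 - a)) * W2plan_sq \<Omega>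
    \<le> ennreal (1 - a) * W2sq \<omega> \<mu>0 + ennreal a * W2sq \<omega> \<mu>1"
proof -
  note [measurable] = transport_planD(3-5)[OF \<Omega>]
  let ?g = "\<lambda>x :: 'a \<times> 'a \<times> 'a. (1 - a) *\<^sub>R fst (snd x) + a *\<^sub>R snd (snd x)"
  have g[measurable]: "?g \<in> \<Omega> \<rightarrow>\<^sub>M borel" by measurable
  have "W2sq \<omega> (gen_geod \<Omega> a) \<le> (\<integral>\<^sup>+ x. ennreal ((norm (fst x - ?g x))\<^sup>2) \<partial>\<Omega>)"
    using W2sq_le_maps[OF transport_planD(1,3)[OF \<Omega>] g]
    unfolding transport_planD(6)[OF \<Omega>] gen_geod_def .
  then have "W2sq \<omega> (gen_geod \<Omega> a) + ennreal (a * (1 - a)) * W2plan_sq \<Omega>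
    \<le> (\<integral>\<^sup>+ x. ennreal ((norm (fst x - ?g x))\<^sup>2)
        + ennreal (a * (1 - a)) * ennreal ((norm (fst (snd x) - snd (snd x)))\<^sup>2) \<partial>\<Omega>)"
    by (simp add: nn_integral_add nn_integral_cmult W2plan_sq_def add_right_mono)
  also have "\<dots> = (\<integral>\<^sup>+ x. ennreal (1 - a) * ennreal ((norm (fst x - fst (snd x)))\<^sup>2)
        + ennreal a * ennreal ((norm (fst x - snd (snd x)))\<^sup>2) \<partial>\<Omega>)"
    using a by (simp add: ennreal_mult[symmetric] ennreal_plus[symmetric]
        norm_diff_convex_combination del: ennreal_plus)
  also have "\<dots> = ennreal (1 - a) * W2sq \<omega> \<mu>0 + ennreal a * W2sq \<omega> \<mu>1"
    by (simp add: nn_integral_add nn_integral_cmult transport_planD(9,10)[OF \<Omega>])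
  finally show ?thesis .
qed

lemma gen_geod_P2:
  assumes \<Omega>: "\<Omega> \<in> transport_plans \<omega> \<mu>0 \<mu>1" and a: "0 \<le> a" "a \<le> 1"
    and P: "\<omega> \<in> P2 \<omega>0" "\<mu>0 \<in> P2 \<omega>0" "\<mu>1 \<in> P2 \<omega>0"
  shows "gen_geod \<Omega> a \<in> P2 \<omega>0"
    and "(W2 \<omega> (gen_geod \<Omega> a))\<^sup>2 \<le> (1 - a) * (W2 \<omega> \<mu>0)\<^sup>2 + a * (W2 \<omega> \<mu>1)\<^sup>2
      - a * (1 - a) * enn2real (W2plan_sq \<Omega>)"
proof -
  note [measurable] = transport_planD(4,5)[OF \<Omega>]
  have fin: "W2plan_sq \<Omega> < \<infinity>"
    using W2plan_sq_le[OF \<Omega> zero_less_one P] by (auto intro: le_less_trans)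
  have le: "W2sq \<omega> (gen_geod \<Omega> a) + ennreal (a * (1 - a)) * W2plan_sq \<Omega>
    \<le> ennreal ((1 - a) * (W2 \<omega> \<mu>0)\<^sup>2 + a * (W2 \<omega> \<mu>1)\<^sup>2)"
    using W2sq_gen_geod[OF \<Omega> a] a unfolding W2sq_eq_P2[OF P(1,2)] W2sq_eq_P2[OF P(1,3)]
    by (simp add: ennreal_mult[symmetric] ennreal_plus[symmetric] del: ennreal_plus)
  have "W2sq \<omega> (gen_geod \<Omega> a) + ennreal (a * (1 - a)) * W2plan_sq \<Omega> < \<infinity>"
    by (rule le_less_trans[OF le]) simp
  then have g_fin: "W2sq \<omega> (gen_geod \<Omega> a) < \<infinity>" by simp
  then have "W2sq (gen_geod \<Omega> a) \<omega>0 < \<infinity>"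
    using W2sq_finite_trans[of "gen_geod \<Omega> a" \<omega> \<omega>0] P(1) by (simp add: W2sq_sym[of "gen_geod \<Omega> a"] P2_def)
  moreover have "prob_space (gen_geod \<Omega> a)" unfolding gen_geod_def
    by (rule prob_space.prob_space_distr[OF transport_planD(1)[OF \<Omega>]]) measurable
  ultimately show gP: "gen_geod \<Omega> a \<in> P2 \<omega>0" by (simp add: P2_def gen_geod_def)
  have "ennreal ((W2 \<omega> (gen_geod \<Omega> a))\<^sup>2 + a * (1 - a) * enn2real (W2plan_sq \<Omega>))
    \<le> ennreal ((1 - a) * (W2 \<omega> \<mu>0)\<^sup>2 + a * (W2 \<omega> \<mu>1)\<^sup>2)"
    using le fin a by (simp add: W2sq_eq_P2[OF P(1) gP] ennreal_mult)
  then have "(W2 \<omega> (gen_geod \<Omega> a))\<^sup>2 + a * (1 - a) * enn2real (W2plan_sq \<Omega>)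
    \<le> (1 - a) * (W2 \<omega> \<mu>0)\<^sup>2 + a * (W2 \<omega> \<mu>1)\<^sup>2"
    using a by (subst (asm) ennreal_le_iff) auto
  then show "(W2 \<omega> (gen_geod \<Omega> a))\<^sup>2 \<le> (1 - a) * (W2 \<omega> \<mu>0)\<^sup>2 + a * (W2 \<omega> \<mu>1)\<^sup>2
      - a * (1 - a) * enn2real (W2plan_sq \<Omega>)" by simp
qed

section \<open>The Wasserstein space satisfies the axioms\<close>

lemma W2_complete_P2:
  assumes s: "\<And>n. s n \<in> P2 \<omega>0" and c: "\<And>n. (W2 (s n) (s (Suc n)))\<^sup>2 \<le> (1/8) ^ n"
  shows "\<exists>l\<in>P2 \<omega>0. (\<lambda>n. W2 (s n) l) \<longlonglongrightarrow> 0"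
proof -
  have p: "prob_space (s n)" "sets (s n) = sets borel" for n using s by (auto simp: P2_def)
  have c': "W2sq (s n) (s (Suc n)) \<le> ennreal ((1/8) ^ n)" for n
    using ennreal_leI[OF c[of n]] by (simp only: W2sq_eq_P2[OF s[of n] s[of "Suc n"]])
  obtain l C where l: "prob_space l" "sets l = sets borel" and C: "0 \<le> C"
    and lim: "\<And>n. W2sq (s n) l \<le> ennreal (C * (1/4) ^ n)"
    by (rule W2sq_complete[of s, OF p c']) (rule that)
  have "W2sq l (s 0) < \<infinity>" unfolding W2sq_sym[of l] by (rule le_less_trans[OF lim]) simp
  then have "W2sq l \<omega>0 < \<infinity>" by (rule W2sq_finite_trans) (use s[of 0] in \<open>simp add: P2_def\<close>)
  then have lP: "l \<in> P2 \<omega>0" using l by (simp add: P2_def)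
  have bound: "W2 (s n) l \<le> sqrt C * (1/2) ^ n" for n
  proof (rule power2_le_imp_le)
    show "(W2 (s n) l)\<^sup>2 \<le> (sqrt C * (1/2) ^ n)\<^sup>2"
      using W2_square_le[OF lim[of n]] C by (simp add: power_mult_distrib half_power_square)
  qed (use C in simp)
  have "(\<lambda>n. sqrt C * (1/2) ^ n) \<longlonglongrightarrow> 0"
    by (intro tendsto_mult_right_zero LIMSEQ_realpow_zero) auto
  then have "(\<lambda>n. W2 (s n) l) \<longlonglongrightarrow> 0"
    by (rule tendsto_sandwich[OF _ _ tendsto_const, rotated 2]) (simp_all add: W2_nonneg bound)
  with lP show ?thesis by blast
qed

lemma evi_space_P2:
  assumes E: "\<forall>\<nu>\<in>P2 \<omega>0. E \<nu> \<noteq> - \<infinity>" and lsc: "W2_lsc \<omega>0 E" and conv: "convex_gen_geod \<omega>0 lam E"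
  shows "evi_space (P2 \<omega>0) W2 E (neg_part lam)"
proof
  have plan: "\<exists>\<Omega>. \<Omega> \<in> transport_plans \<omega> \<mu>0 \<mu>1" if "\<mu>0 \<in> P2 \<omega>0" "\<mu>1 \<in> P2 \<omega>0" "\<omega> \<in> P2 \<omega>0" for \<mu>0 \<mu>1 \<omega>
    using conv that unfolding convex_gen_geod_def by blast
  show "W2 x z \<le> W2 x y + W2 y z" if "x \<in> P2 \<omega>0" "y \<in> P2 \<omega>0" "z \<in> P2 \<omega>0" for x y z
    using plan[OF that(1,3,2)] W2_triangle_plan that by (metis W2_sym)
  show "\<exists>g D. (W2 x y)\<^sup>2 \<le> D \<and> (\<forall>a\<in>{0..1}. g a \<in> P2 \<omega>0 \<and>
      (W2 w (g a))\<^sup>2 \<le> (1 - a) * (W2 w x)\<^sup>2 + a * (W2 w y)\<^sup>2 - a * (1 - a) * D \<and>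
      E (g a) \<le> ereal (1 - a) * E x + ereal a * E y + ereal (a * (1 - a) * (neg_part lam / 2) * D))"
    if P: "w \<in> P2 \<omega>0" "x \<in> P2 \<omega>0" "y \<in> P2 \<omega>0" for w x y
  proof -
    obtain \<Omega> where \<Omega>: "\<Omega> \<in> transport_plans w x y" and le: "\<And>a. a \<in> {0..1} \<Longrightarrow>
        E (gen_geod \<Omega> a) \<le> ereal (1 - a) * E x + ereal a * E y
            - ereal (a * (1 - a) * (lam / 2) * enn2real (W2plan_sq \<Omega>))"
      using conv P unfolding convex_gen_geod_def by blast
    have "W2plan_sq \<Omega> < \<infinity>" using W2plan_sq_le[OF \<Omega> zero_less_one P] by (auto intro: le_less_trans)
    then have "(W2 x y)\<^sup>2 \<le> enn2real (W2plan_sq \<Omega>)"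
      using W2sq_le_W2plan_sq[OF \<Omega>] by (intro W2_square_le) auto
    moreover have "E (gen_geod \<Omega> a) \<le> ereal (1 - a) * E x + ereal a * E y
        + ereal (a * (1 - a) * (neg_part lam / 2) * enn2real (W2plan_sq \<Omega>))" if a: "a \<in> {0..1}" for a
    proof -
      \<comment> \<open>Since \<open>- lam \<le> neg_part lam\<close>, the term subtracted in the
        hypothesis is dominated by the one added in \<open>E_convex\<close>.\<close>
      have "a * (1 - a) * (- (lam / 2)) * enn2real (W2plan_sq \<Omega>)
          \<le> a * (1 - a) * (neg_part lam / 2) * enn2real (W2plan_sq \<Omega>)"
        using a by (intro mult_right_mono mult_left_mono) (auto simp: neg_part_def)
      then have "- ereal (a * (1 - a) * (lam / 2) * enn2real (W2plan_sq \<Omega>))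
          \<le> ereal (a * (1 - a) * (neg_part lam / 2) * enn2real (W2plan_sq \<Omega>))" by simp
      then show ?thesis
        by (intro order_trans[OF le[OF a]]) (simp only: minus_ereal_def add_left_mono)
    qed
    ultimately show ?thesis
      using gen_geod_P2[OF \<Omega> _ _ P]
      by (intro exI[of _ "gen_geod \<Omega>"] exI[of _ "enn2real (W2plan_sq \<Omega>)"]) auto
  qed
  show "E x \<le> liminf (\<lambda>n. E (s n))"
    if "x \<in> P2 \<omega>0" "\<And>n. s n \<in> P2 \<omega>0" "(\<lambda>n. W2 (s n) x) \<longlonglongrightarrow> 0" for x s
    using lsc that unfolding W2_lsc_def by blast
  show "W2 x x = 0" if "x \<in> P2 \<omega>0" for x
    using that W2sq_self[of x] by (simp add: W2_def P2_def)
  show "\<exists>l\<in>P2 \<omega>0. (\<lambda>n. W2 (s n) l) \<longlonglongrightarrow> 0"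
    if "\<And>n. s n \<in> P2 \<omega>0" "\<And>n. (W2 (s n) (s (Suc n)))\<^sup>2 \<le> (1/8) ^ n" for s
    using that by (rule W2_complete_P2)
qed (use E in \<open>auto simp: W2_nonneg neg_part_def intro: W2_sym\<close>)

lemma coercive_lower_bound:
  assumes "coercive \<omega>0 E"
  obtains t0 u C where "0 < t0" "u \<in> P2 \<omega>0"
    and "\<And>v. v \<in> P2 \<omega>0 \<Longrightarrow> ereal C \<le> ereal ((W2 u v)\<^sup>2 / (2 * t0)) + E v"
proof -
  obtain t0 u where t0: "0 < t0" and u: "u \<in> P2 \<omega>0"
    and inf: "- \<infinity> < (INF v\<in>P2 \<omega>0. enn2ereal (W2sq u v) / ereal (2 * t0) + E v)"
    using assms unfolding coercive_def by blast
  \<comment> \<open>A real number below the infimum is taken, because the infimum itself may be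
    \<open>\<infinity>\<close> here.\<close>
  obtain C where C: "ereal C < (INF v\<in>P2 \<omega>0. enn2ereal (W2sq u v) / ereal (2 * t0) + E v)"
    using ereal_dense2[OF inf] by blast
  have "ereal C \<le> ereal ((W2 u v)\<^sup>2 / (2 * t0)) + E v" if v: "v \<in> P2 \<omega>0" for v
    using less_le_trans[OF C INF_lower[OF v]] t0 by (simp add: W2sq_eq_P2[OF u v] less_imp_le)
  with t0 u show thesis by (rule that)
qed

section \<open>The estimate for the resolvents\<close>

theorem theorem2p4:
  fixes \<omega>0 :: "'a::euclidean_space measure" and E :: "'a measure \<Rightarrow> ereal"
    and lam h \<tau> :: real and \<mu> :: "'a measure" and n m :: nat
  assumes "\<omega>0 \<in> P2 \<omega>0"
    and "\<forall>\<nu>\<in>P2 \<omega>0. E \<nu> \<noteq> - \<infinity>"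
    and "proper_fun \<omega>0 E" and "coercive \<omega>0 E" and "W2_lsc \<omega>0 E"
    and "convex_gen_geod \<omega>0 lam E"
    and "\<mu> \<in> dom_slope \<omega>0 E"
    and "0 < h" and "h \<le> \<tau>" and "neg_part lam * \<tau> < 1"
    and "1 \<le> n" and "1 \<le> m"
  shows "(1 - neg_part lam * h)\<^sup>2 *
           (W2 ((resolvent \<omega>0 E \<tau> ^^ n) \<mu>) ((resolvent \<omega>0 E h ^^ m) \<mu>))\<^sup>2
         \<le> h / \<tau> * (1 / (1 - neg_part lam * \<tau>)) *
             (W2 ((resolvent \<omega>0 E \<tau> ^^ (n - 1)) \<mu>) ((resolvent \<omega>0 E h ^^ (m - 1)) \<mu>))\<^sup>2
           + (\<tau> - h) / \<tau> *
             (W2 ((resolvent \<omega>0 E h ^^ (m - 1)) \<mu>) ((resolvent \<omega>0 E \<tau> ^^ n) \<mu>))\<^sup>2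
           + 2 * h\<^sup>2 * (1 / (1 - neg_part lam * h) ^ (2 * m)) * (real_of_ereal (slope \<omega>0 E \<mu>))\<^sup>2"
proof -
  define L where "L = neg_part lam"
  interpret evi_space "P2 \<omega>0" W2 E L
    unfolding L_def using assms(2,5,6) by (rule evi_space_P2)
  obtain t0 u C where coer: "0 < t0" "u \<in> P2 \<omega>0"
    "\<And>v. v \<in> P2 \<omega>0 \<Longrightarrow> ereal C \<le> ereal ((W2 u v)\<^sup>2 / (2 * t0)) + E v"
    using coercive_lower_bound[OF assms(4)] by metis
  \<comment> \<open>The choice in \<open>resolvent\<close> returns a minimizer as soon as one
    exists, and the estimates above hold for every minimizer.\<close>
  have J: "is_minimizer t w (resolvent \<omega>0 E t w)" if t: "0 < t" "L * t < 1" and w: "w \<in> fin_dom" for t w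
  proof -
    have wP: "w \<in> P2 \<omega>0" using w by (rule fin_dom_subset)
    have "is_minimizer t w = (\<lambda>\<nu>. \<nu> \<in> P2 \<omega>0 \<and> (\<forall>\<nu>'\<in>P2 \<omega>0.
      enn2ereal (W2sq w \<nu>) / ereal (2 * t) + E \<nu> \<le> enn2ereal (W2sq w \<nu>') / ereal (2 * t) + E \<nu>'))"
      using t by (auto simp: fun_eq_iff is_minimizer_def W2sq_eq_P2[OF wP])
    then have "resolvent \<omega>0 E t w = (SOME \<nu>. is_minimizer t w \<nu>)" by (simp add: resolvent_def)
    then show ?thesis using someI_ex[OF minimizer_exists[OF w t coer(2,1,3)]] by simp
  qed
  have \<mu>: "\<mu> \<in> fin_dom" and s: "E_slope \<mu> < \<infinity>"
    using assms(7) by (auto simp: dom_slope_def fin_dom_def slope_def E_slope_def)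
  have \<tau>: "0 < \<tau>" "L * \<tau> < 1" using assms(8-10) by (auto simp: L_def)
  have "L * h \<le> L * \<tau>" using assms(9) L_nonneg by (rule mult_left_mono)
  then have h: "0 < h" "L * h < 1" using assms(8) \<tau> by auto
  note J\<tau> = J[OF \<tau>] and Jh = J[OF h]
  define a b where "a = (resolvent \<omega>0 E \<tau> ^^ (n - 1)) \<mu>" and "b = (resolvent \<omega>0 E h ^^ (m - 1)) \<mu>"
  have ab: "a \<in> fin_dom" "b \<in> fin_dom"
    unfolding a_def b_def using iterates[OF J\<tau> \<mu>] iterates[OF Jh \<mu>] by blast+
  have A: "(resolvent \<omega>0 E \<tau> ^^ n) \<mu> = resolvent \<omega>0 E \<tau> a" using assms(11) by (cases n) (auto simp: a_def)
  have B: "(resolvent \<omega>0 E h ^^ m) \<mu> = resolvent \<omega>0 E h b" using assms(12) by (cases m) (auto simp: b_def)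
  define y where "y = 1 - L * h"
  have y: "0 < y" "y \<le> 1" using h L_nonneg by (auto simp: y_def)
  define \<sigma> where "\<sigma> = (real_of_ereal (slope \<omega>0 E \<mu>))\<^sup>2"
  \<comment> \<open>The drop estimate after \<open>m - 1\<close> iterations has exponent
    \<open>2 * (m - 1)\<close> and constant 1; as \<open>y \<le> 1\<close>, these may be enlarged to
    \<open>2 * m\<close> and 2.\<close>
  have "1 / y ^ (2 * (m - 1)) \<le> 1 / y ^ (2 * m)"
    using y by (intro divide_left_mono power_decreasing) auto
  then have "h\<^sup>2 * (1 / y ^ (2 * (m - 1))) * \<sigma> \<le> 2 * h\<^sup>2 * (1 / y ^ (2 * m)) * \<sigma>"
    using y h by (intro mult_right_mono mult_mono) (auto simp: \<sigma>_def)
  moreover have "y * (2 * h * (fin_E b - fin_E (resolvent \<omega>0 E h b)) - (W2 b (resolvent \<omega>0 E h b))\<^sup>2)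
      \<le> h\<^sup>2 * (1 / y ^ (2 * (m - 1))) * \<sigma>"
    using energy_drop_bound[OF Jh \<mu> s h, of "m - 1"]
    by (simp add: b_def y_def \<sigma>_def slope_def E_slope_def)
  ultimately show ?thesis
    using one_step[OF ab J\<tau>[OF ab(1)] Jh[OF ab(2)] h(1) assms(9) \<tau>(2)]
    unfolding A B a_def[symmetric] b_def[symmetric] L_def[symmetric] y_def[symmetric] \<sigma>_def[symmetric]
    by linarith
qed

end
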